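(* Let $g\in \mathrm{SL}_2(\mathbb{C})$ and $\mathbf a\in\mathbf A$. There exists a unique isomorphism of $\mathbb{C}[[\hbar]]$-algebras $$\widehat\varphi^*_{g,\hbar}(\mathbf a)\colon (\widehat A,\ast_{\mathbf a.g})\longrightarrow(\widehat A,\ast_{\mathbf a})$$ which intertwines the pull-back $\varphi_g^*(\mathbf a)\colon (A_0,\{\cdot,\cdot\}_{\mathbf a.g})\to(A_0,\{\cdot,\cdot\}_{\mathbf a})$ with the semiclassical limits, i.e. such that $$\sigma\circ\widehat\varphi^*_{g,\hbar}(\mathbf a)=\varphi^*_g(\mathbf a)\circ\sigma .$$ Moreover, if $g'\in \mathrm{SL}_2(\mathbb{C})$ is another element then $\widehat\varphi^*_{gg',\hbar}(\mathbf a)=\widehat\varphi^*_{g,\hbar}(\mathbf a)\circ\widehat\varphi^*_{g',\hbar}(\mathbf a.g)$.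
   Context: All vector spaces and algebras are over $\mathbb{C}$. Let $J$ be a finite set, $V=\bigoplus_{j\in J}W^j$ a finite-dimensional $J$-graded vector space, and $\mathbb{M}=\bigoplus_{i\neq j\in J}\mathrm{Hom}(W^j,W^i)$, with elements $B=(B^{ij})$, $B^{ij}\in \mathrm{Hom}(W^j,W^i)$. Let $\mathbf A$ be the set of injective maps $\mathbf a\colon J\to\mathbb{C}\cup\{\infty\}$, $a_j:=\mathbf a(j)$. Action on $\mathbf A$. The group $\mathrm{SL}_2(\mathbb{C})$ acts on $\mathbf A$ on the right: for $g=\begin{pmatrix}a&b\\c&d\end{pmatrix}$, $(\mathbf a.g)(j)=-\frac{b-da_j}{a-ca_j}$ if $a_j\ne\infty$ and $a\neq ca_j$; $(\mathbf a.g)(j)=\infty$ if $a_j\neq\infty$ and $a=ca_j$; $(\mathbf a.g)(j)=-d/c$ if $a_j=\infty$, $c\ne0$; $(\mathbf a.g)(j)=\infty$ if $a_j=\infty$, $c=0$. Functions $\eta_i$. For $i\in J$ define $\eta_i(g,\mathbf a)\in\mathbb{C}^\times$ by: $(a-ca_i)^{-1}$ if $a_i\neq\infty$, $a\ne ca_i$; $(b-da_i)^{-1}$ if $a_i\neq\infty$, $a=ca_i$; $c^{-1}$ if $a_i=\infty$, $c\neq0$; $a$ if $a_i=\infty$, $c=0$. Let $\varphi_g(\mathbf a)\in \mathrm{GL}(\mathbb{M})$ be the map $B^{ij}\mapsto\eta_i(g,\mathbf a)B^{ij}$, and $\varphi_g^*(\mathbf a)$ the pull-back of functions along it. Poisson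 structure. For $i\ne j$ define $\varepsilon_{ij}(\mathbf a)\in\mathbb{C}^\times$ by $\varepsilon_{ij}+\varepsilon_{ji}=0$, $\varepsilon_{ij}(\mathbf a)=\frac1{a_i-a_j}$ if $a_i,a_j\neq\infty$, $\varepsilon_{ij}(\mathbf a)=1$ if $a_j=\infty$. The symplectic form is $\omega_{\mathbf a}=\sum_{i\neq j}\frac{\varepsilon_{ij}(\mathbf a)}2\mathrm{Tr}(dB^{ij}\wedge dB^{ji})$, and $\{\cdot,\cdot\}_{\mathbf a}=\omega_{\mathbf a}^{-1}$ is the Poisson bracket on $A_0=\mathbb{C}[\mathbb{M}]\cong\mathrm{Sym}(\mathbb{M}^* )$; in coordinates (matrix entries) $\{B^{ij}_{kl},B^{ji}_{lk}\}_{\mathbf a}=\varepsilon_{ij}(\mathbf a)^{-1}$, all other brackets of coordinates being zero. Quantisation. The Weyl algebra $(A,\ast_{\mathbf a})$ is $\mathrm{Tens}(\mathbb{M}^* )$ modulo the two-sided ideal generated by $f\otimes h-h\otimes f-\{f,h\}_{\mathbf a}$, $f,h\in\mathbb{M}^*$. The Bernstein filtration is $\mathcal{B}_{\le k}=$ image of $\bigoplus_{m\le k}(\mathbb{M}^* )^{\otimes m}$, and one has $\mathrm{gr}(A)\cong A_0$, with projections $\sigma_k\colon\mathcal{B}_{\le k}\to\mathcal{B}_{\le k}/\mathcal{B}_{\le k-1}\cong\mathrm{Sym}^k(\mathbb{M}^* )$. The order of $x\in A$ is $|x|=\min\{k: x\in\mathcal{B}_{\le k}\}$. The completed Rees algebra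 is $$\widehat A=\Big\{\sum_{k\ge0}f_k\hbar^k \;\Big|\; f_k\in\mathcal{B}_{\le k},\ \lim_{k\to\infty}(k-|f_k|)=+\infty\Big\}\subseteq A[[\hbar]],$$ with the product induced by $\ast_{\mathbf a}$. The semiclassical limit is $\sigma\colon\widehat A\to A_0$, $\sum_kf_k\hbar^k\mapsto\sum_k\sigma_k(f_k)$ (a finite sum).
   Formalization: Uniqueness is claimed only among isomorphisms mapping ħM* into ħM*, and the cocycle identity concerns these; literal uniqueness fails for M≠0, since f ↦ f + c(f), c a nonzero linear form on M*, induces a nontrivial automorphism of Â preserving σ. *)

theory Defs
  imports
    "HOL-Analysis.Analysis"
    "HOL-Algebra.QuotRing"
    "HOL-Library.Poly_Mapping"
    "HOL-Computational_Algebra.Formal_Power_Series"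
begin

section \<open>The action of \<open>SL\<^sub>2(\<complex>)\<close> on embeddings into the Riemann sphere\<close>

datatype cp1 = Fin complex | Infty

definition SL2 :: "(complex^2^2) set" where
  "SL2 = {g. det g = 1}"

definition embeddings :: "'j set \<Rightarrow> ('j \<Rightarrow> cp1) set" where
  "embeddings J = {a. inj_on a J}"

fun mobius :: "complex^2^2 \<Rightarrow> cp1 \<Rightarrow> cp1" where
  "mobius g (Fin z) =
     (if g$1$1 \<noteq> g$2$1 * z then Fin (- (g$1$2 - g$2$2 * z) / (g$1$1 - g$2$1 * z)) else Infty)"
| "mobius g Infty = (if g$2$1 \<noteq> 0 then Fin (- g$2$2 / g$2$1) else Infty)"

definition act :: "('j \<Rightarrow> cp1) \<Rightarrow> complex^2^2 \<Rightarrow> 'j \<Rightarrow> cp1" where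
  "act a g = (\<lambda>j. mobius g (a j))"

fun eta_pt :: "complex^2^2 \<Rightarrow> cp1 \<Rightarrow> complex" where
  "eta_pt g (Fin z) =
     (if g$1$1 \<noteq> g$2$1 * z then inverse (g$1$1 - g$2$1 * z) else inverse (g$1$2 - g$2$2 * z))"
| "eta_pt g Infty = (if g$2$1 \<noteq> 0 then inverse (g$2$1) else g$1$1)"

definition eta :: "'j \<Rightarrow> complex^2^2 \<Rightarrow> ('j \<Rightarrow> cp1) \<Rightarrow> complex" where
  "eta i g a = eta_pt g (a i)"

text \<open>The value at \<open>(Infty, Infty)\<close> is irrelevant: it does not occur for \<open>i \<noteq> j\<close> and injective \<open>a\<close>.\<close>

fun eps_pt :: "cp1 \<Rightarrow> cp1 \<Rightarrow> complex" where
  "eps_pt (Fin z) (Fin w) = 1 / (z - w)"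
| "eps_pt (Fin z) Infty = 1"
| "eps_pt Infty (Fin w) = - 1"
| "eps_pt Infty Infty = 0"

definition eps :: "('j \<Rightarrow> cp1) \<Rightarrow> 'j \<Rightarrow> 'j \<Rightarrow> complex" where
  "eps a i j = eps_pt (a i) (a j)"


section \<open>The representation space and its polynomial functions\<close>

text \<open>
  The graded pieces are \<open>W\<^sup>j = \<complex>\<^bsup>d j\<^esup>\<close> for \<open>j \<in> J\<close>.  The tuple \<open>(i, j, k, l)\<close> stands for the
  coordinate function \<open>B\<^sup>i\<^sup>j\<^sub>k\<^sub>l\<close>, the \<open>(k, l)\<close> matrix entry of \<open>B\<^sup>i\<^sup>j \<in> Hom(W\<^sup>j, W\<^sup>i)\<close>, so that
  \<open>coords J d\<close> indexes a basis of the dual of the representation space \<open>\<M>\<close>.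
\<close>

type_synonym 'j coord = "'j \<times> 'j \<times> nat \<times> nat"

definition coords :: "'j set \<Rightarrow> ('j \<Rightarrow> nat) \<Rightarrow> 'j coord set" where
  "coords J d = {(i, j, k, l). i \<in> J \<and> j \<in> J \<and> i \<noteq> j \<and> k < d i \<and> l < d j}"

definition rep_space :: "'j set \<Rightarrow> ('j \<Rightarrow> nat) \<Rightarrow> ('j coord \<Rightarrow> complex) set" where
  "rep_space J d = {B. \<forall>x. x \<notin> coords J d \<longrightarrow> B x = 0}"

definition phi :: "complex^2^2 \<Rightarrow> ('j \<Rightarrow> cp1) \<Rightarrow> ('j coord \<Rightarrow> complex) \<Rightarrow> 'j coord \<Rightarrow> complex" where
  "phi g a B = (\<lambda>(i, j, k, l). eta i g a * B (i, j, k, l))"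

text \<open>Elements of \<open>A\<^sub>0 = \<complex>[\<M>]\<close> are functions on \<open>\<M>\<close>, extensional outside \<open>\<M>\<close>.\<close>

definition pullback ::
  "'j set \<Rightarrow> ('j \<Rightarrow> nat) \<Rightarrow> complex^2^2 \<Rightarrow> ('j \<Rightarrow> cp1) \<Rightarrow>
    (('j coord \<Rightarrow> complex) \<Rightarrow> complex) \<Rightarrow> ('j coord \<Rightarrow> complex) \<Rightarrow> complex" where
  "pullback J d g a p = (\<lambda>B \<in> rep_space J d. p (phi g a B))"


section \<open>The tensor algebra of the dual\<close>

text \<open>
  As \<open>\<M>\<^sup>*\<close> has the basis \<open>coords J d\<close>, its tensor algebra is the monoid algebra of the words in
  these letters.  Words are written additively since the product on \<open>\<Rightarrow>\<^sub>0\<close> is the convolution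
  for a monoid in class \<^class>\<open>monoid_add\<close>.
\<close>

datatype 'x word = Word (letters: "'x list")

instantiation word :: (type) monoid_add
begin

definition zero_word :: "'a word" where
  "0 = Word []"

definition plus_word :: "'a word \<Rightarrow> 'a word \<Rightarrow> 'a word" where
  "v + w = Word (letters v @ letters w)"

instance
  by standard (simp_all add: zero_word_def plus_word_def)

end

type_synonym 'x tensor = "'x word \<Rightarrow>\<^sub>0 complex"

abbreviation wlen :: "'x word \<Rightarrow> nat" where
  "wlen w \<equiv> length (letters w)"

definition tens :: "'j set \<Rightarrow> ('j \<Rightarrow> nat) \<Rightarrow> 'j coord tensor ring" where
  "tens J d =
    \<lparr>carrier = {t. \<forall>w \<in> Poly_Mapping.keys t. set (letters w) \<subseteq> coords J d},
     mult = (*), one = 1, zero = 0, add = (+)\<rparr>"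

definition dual :: "'j set \<Rightarrow> ('j \<Rightarrow> nat) \<Rightarrow> 'j coord tensor set" where
  "dual J d = {f \<in> carrier (tens J d). \<forall>w \<in> Poly_Mapping.keys f. wlen w = 1}"

text \<open>The polynomial function on \<open>\<M>\<close> given by the image in \<open>Sym\<^sup>k(\<M>\<^sup>*)\<close> of the degree \<open>k\<close> part.\<close>

definition sym_part ::
  "'j set \<Rightarrow> ('j \<Rightarrow> nat) \<Rightarrow> nat \<Rightarrow> 'j coord tensor \<Rightarrow> ('j coord \<Rightarrow> complex) \<Rightarrow> complex" where
  "sym_part J d k t = (\<lambda>B \<in> rep_space J d.
     \<Sum>w | w \<in> Poly_Mapping.keys t \<and> wlen w = k. Poly_Mapping.lookup t w * prod_list (map B (letters w)))"


section \<open>The Weyl algebra\<close>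

fun coord_bracket :: "('j \<Rightarrow> cp1) \<Rightarrow> 'j coord \<Rightarrow> 'j coord \<Rightarrow> complex" where
  "coord_bracket a (i, j, k, l) (i', j', k', l') =
     (if i' = j \<and> j' = i \<and> k' = l \<and> l' = k then inverse (eps a i j) else 0)"

definition dual_bracket ::
  "'j set \<Rightarrow> ('j \<Rightarrow> nat) \<Rightarrow> ('j \<Rightarrow> cp1) \<Rightarrow> 'j coord tensor \<Rightarrow> 'j coord tensor \<Rightarrow> complex" where
  "dual_bracket J d a f h = (\<Sum>x \<in> coords J d. \<Sum>y \<in> coords J d.
     Poly_Mapping.lookup f (Word [x]) * Poly_Mapping.lookup h (Word [y]) * coord_bracket a x y)"

definition weyl_ideal :: "'j set \<Rightarrow> ('j \<Rightarrow> nat) \<Rightarrow> ('j \<Rightarrow> cp1) \<Rightarrow> 'j coord tensor set" where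
  "weyl_ideal J d a = genideal (tens J d)
     {f * h - h * f - Poly_Mapping.single 0 (dual_bracket J d a f h) | f h. f \<in> dual J d \<and> h \<in> dual J d}"

definition weyl :: "'j set \<Rightarrow> ('j \<Rightarrow> nat) \<Rightarrow> ('j \<Rightarrow> cp1) \<Rightarrow> 'j coord tensor set ring" where
  "weyl J d a = tens J d Quot weyl_ideal J d a"

definition weyl_class ::
  "'j set \<Rightarrow> ('j \<Rightarrow> nat) \<Rightarrow> ('j \<Rightarrow> cp1) \<Rightarrow> 'j coord tensor \<Rightarrow> 'j coord tensor set" where
  "weyl_class J d a t = weyl_ideal J d a +>\<^bsub>tens J d\<^esub> t"

definition tens_le :: "'j set \<Rightarrow> ('j \<Rightarrow> nat) \<Rightarrow> nat \<Rightarrow> 'j coord tensor set" where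
  "tens_le J d k = {t \<in> carrier (tens J d). \<forall>w \<in> Poly_Mapping.keys t. wlen w \<le> k}"

definition bernstein ::
  "'j set \<Rightarrow> ('j \<Rightarrow> nat) \<Rightarrow> ('j \<Rightarrow> cp1) \<Rightarrow> nat \<Rightarrow> 'j coord tensor set set" where
  "bernstein J d a k = weyl_class J d a ` tens_le J d k"

definition weyl_order ::
  "'j set \<Rightarrow> ('j \<Rightarrow> nat) \<Rightarrow> ('j \<Rightarrow> cp1) \<Rightarrow> 'j coord tensor set \<Rightarrow> nat" where
  "weyl_order J d a x = (LEAST k. x \<in> bernstein J d a k)"

text \<open>
  The projection \<open>\<sigma>\<^sub>k\<close> onto \<open>Sym\<^sup>k(\<M>\<^sup>*)\<close>: the symbol of \<open>x\<close> in filtration degree \<open>\<le> k\<close> is the common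
  degree \<open>k\<close> part, in the symmetric algebra, of all representatives of degree \<open>\<le> k\<close>.
\<close>

definition symb ::
  "'j set \<Rightarrow> ('j \<Rightarrow> nat) \<Rightarrow> ('j \<Rightarrow> cp1) \<Rightarrow> nat \<Rightarrow> 'j coord tensor set \<Rightarrow>
    ('j coord \<Rightarrow> complex) \<Rightarrow> complex" where
  "symb J d a k x = (THE p. \<exists>t \<in> tens_le J d k. x = weyl_class J d a t \<and> p = sym_part J d k t)"


section \<open>The completed Rees algebra\<close>

text \<open>The series \<open>\<Sum>\<^sub>k f\<^sub>k \<hbar>\<^sup>k\<close> is represented by its coefficient sequence \<open>f\<close>.\<close>

definition rees ::
  "'j set \<Rightarrow> ('j \<Rightarrow> nat) \<Rightarrow> ('j \<Rightarrow> cp1) \<Rightarrow> (nat \<Rightarrow> 'j coord tensor set) ring" where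
  "rees J d a =
    \<lparr>carrier = {f. (\<forall>k. f k \<in> bernstein J d a k) \<and>
                   filterlim (\<lambda>k. int k - int (weyl_order J d a (f k))) at_top sequentially},
     mult = (\<lambda>f h k. finsum (weyl J d a) (\<lambda>i. f i \<otimes>\<^bsub>weyl J d a\<^esub> h (k - i)) {..k}),
     one = (\<lambda>k. if k = 0 then \<one>\<^bsub>weyl J d a\<^esub> else \<zero>\<^bsub>weyl J d a\<^esub>),
     zero = (\<lambda>k. \<zero>\<^bsub>weyl J d a\<^esub>),
     add = (\<lambda>f h k. f k \<oplus>\<^bsub>weyl J d a\<^esub> h k)\<rparr>"

text \<open>The structure map \<open>\<complex>[[\<hbar>]] \<rightarrow> A[[\<hbar>]]\<close>, through which the Rees algebra is a \<open>\<complex>[[\<hbar>]]\<close>-algebra.\<close>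

definition rees_const ::
  "'j set \<Rightarrow> ('j \<Rightarrow> nat) \<Rightarrow> ('j \<Rightarrow> cp1) \<Rightarrow> complex fps \<Rightarrow> nat \<Rightarrow> 'j coord tensor set" where
  "rees_const J d a c = (\<lambda>k. weyl_class J d a (Poly_Mapping.single 0 (fps_nth c k)))"

definition rees_alg_iso ::
  "'j set \<Rightarrow> ('j \<Rightarrow> nat) \<Rightarrow> ('j \<Rightarrow> cp1) \<Rightarrow> ('j \<Rightarrow> cp1) \<Rightarrow>
    ((nat \<Rightarrow> 'j coord tensor set) \<Rightarrow> nat \<Rightarrow> 'j coord tensor set) set" where
  "rees_alg_iso J d a b =
    {\<Phi> \<in> extensional (carrier (rees J d a)).
       \<Phi> \<in> ring_iso (rees J d a) (rees J d b) \<and>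
       (\<forall>c. \<forall>f \<in> carrier (rees J d a).
          \<Phi> (rees_const J d a c \<otimes>\<^bsub>rees J d a\<^esub> f) = rees_const J d b c \<otimes>\<^bsub>rees J d b\<^esub> \<Phi> f)}"

text \<open>
  The sum over \<open>k\<close> is finite: \<open>\<sigma>\<^sub>k(f\<^sub>k) = 0\<close> as soon as \<open>k\<close> exceeds the order of \<open>f\<^sub>k\<close>.
\<close>

definition semiclassical ::
  "'j set \<Rightarrow> ('j \<Rightarrow> nat) \<Rightarrow> ('j \<Rightarrow> cp1) \<Rightarrow> (nat \<Rightarrow> 'j coord tensor set) \<Rightarrow>
    ('j coord \<Rightarrow> complex) \<Rightarrow> complex" where
  "semiclassical J d a f = (\<lambda>B \<in> rep_space J d. Sum_any (\<lambda>k. symb J d a k (f k) B))"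


section \<open>Quantisation of the action\<close>

definition intertwines ::
  "'j set \<Rightarrow> ('j \<Rightarrow> nat) \<Rightarrow> complex^2^2 \<Rightarrow> ('j \<Rightarrow> cp1) \<Rightarrow>
    ((nat \<Rightarrow> 'j coord tensor set) \<Rightarrow> nat \<Rightarrow> 'j coord tensor set) \<Rightarrow> bool" where
  "intertwines J d g a \<Phi> \<longleftrightarrow>
    (\<forall>f \<in> carrier (rees J d (act a g)).
       semiclassical J d a (\<Phi> f) = pullback J d g a (semiclassical J d (act a g) f))"

definition hbar_gen ::
  "'j set \<Rightarrow> ('j \<Rightarrow> nat) \<Rightarrow> ('j \<Rightarrow> cp1) \<Rightarrow> 'j coord tensor \<Rightarrow> nat \<Rightarrow> 'j coord tensor set" where
  "hbar_gen J d a f = (\<lambda>k. if k = 1 then weyl_class J d a f else \<zero>\<^bsub>weyl J d a\<^esub>)"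

text \<open>
  \<open>\<Phi>\<close> maps the generating subspace \<open>\<hbar>\<M>\<^sup>*\<close> into itself, that is, it comes from a linear map of \<open>\<M>\<^sup>*\<close>.
  The semiclassical limit alone does not determine an isomorphism: a translation
  \<open>f \<mapsto> f + c(f)\<close>, with \<open>c\<close> a linear form on \<open>\<M>\<^sup>*\<close>, extends to an automorphism of the Weyl algebra
  that preserves the Bernstein filtration and all symbols, and so to one of the completed Rees
  algebra over \<open>\<complex>[[\<hbar>]]\<close> compatible with the semiclassical limit.  Isomorphisms are
  therefore taken to be linear on generators wherever uniqueness is asserted.
\<close>

definition linear_on_gens ::
  "'j set \<Rightarrow> ('j \<Rightarrow> nat) \<Rightarrow> ('j \<Rightarrow> cp1) \<Rightarrow> ('j \<Rightarrow> cp1) \<Rightarrow>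
    ((nat \<Rightarrow> 'j coord tensor set) \<Rightarrow> nat \<Rightarrow> 'j coord tensor set) \<Rightarrow> bool" where
  "linear_on_gens J d a b \<Phi> \<longleftrightarrow>
    (\<forall>f \<in> dual J d. \<exists>h \<in> dual J d. \<Phi> (hbar_gen J d a f) = hbar_gen J d b h)"

definition is_quantum_pullback ::
  "'j set \<Rightarrow> ('j \<Rightarrow> nat) \<Rightarrow> complex^2^2 \<Rightarrow> ('j \<Rightarrow> cp1) \<Rightarrow>
    ((nat \<Rightarrow> 'j coord tensor set) \<Rightarrow> nat \<Rightarrow> 'j coord tensor set) \<Rightarrow> bool" where
  "is_quantum_pullback J d g a \<Phi> \<longleftrightarrow>
     \<Phi> \<in> rees_alg_iso J d (act a g) a \<and> linear_on_gens J d (act a g) a \<Phi> \<and> intertwines J d g a \<Phi>"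

definition quantum_pullback ::
  "'j set \<Rightarrow> ('j \<Rightarrow> nat) \<Rightarrow> complex^2^2 \<Rightarrow> ('j \<Rightarrow> cp1) \<Rightarrow>
    (nat \<Rightarrow> 'j coord tensor set) \<Rightarrow> nat \<Rightarrow> 'j coord tensor set" where
  "quantum_pullback J d g a = (THE \<Phi>. is_quantum_pullback J d g a \<Phi>)"

end

theory Submission
  imports Defs
begin

text \<open>
  The homomorphism is forced on generators: it is \<open>\<hbar>x \<mapsto> \<eta>\<^sub>i(g, a) \<hbar>x\<close> for a coordinate
  \<open>x = B\<^sup>i\<^sup>j\<^sub>k\<^sub>l\<close>, and everything rests on why this respects the commutation relations and why it is
  determined by its symbols.

  Represent a point of the Riemann sphere by the vector \<open>v(z) = (z, 1)\<close>,
  \<open>v(\<infinity>) = (-1, 0)\<close> of \<open>\<complex>\<^sup>2\<close>.  With this choice of signs \<open>\<epsilon>(p, q)\<close> is the inverse of the area form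
  on \<open>v(p), v(q)\<close>, and all four cases in the definition of \<open>\<eta>\<close> say the same thing, namely
  \<open>g\<^sup>-\<^sup>1 v(p) = \<eta>(g, p)\<^sup>-\<^sup>1 v(p.g)\<close> (\<open>inv_apply_hom_coords\<close>).  The cocycle law for \<open>\<eta>\<close> is then the
  associativity of matrix multiplication, and \<open>\<epsilon>(p, q) = \<eta>(g, p) \<eta>(g, q) \<epsilon>(p.g, q.g)\<close>
  (\<open>eps_pt_mobius\<close>) is the invariance of area under \<open>SL\<^sub>2\<close>.

  By covariance, the rescaling of letters by \<open>\<eta>\<close> in the tensor algebra carries the
  defining ideal of the one Weyl algebra onto that of the other.  It preserves word length, so it passes to the Weyl
  algebras, their filtrations and the completed Rees algebras (\<open>rees_dilate_iso\<close>).  A Weyl algebra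
  element is a coset, a set of tensors, and the induced map simply takes the image of this set.
  Functoriality in \<open>g\<close> is then the cocycle law.

  That the symbol of a Weyl algebra element does not depend on the chosen
  representative is the injective half of the isomorphism of \<open>gr A\<close> with the symmetric algebra.
  It is proved by letting \<open>x\<close> act on formal power series in the coordinates by
  multiplication by \<open>x\<close> plus one half of the Hamiltonian vector field of \<open>x\<close>.  These operators
  satisfy the Weyl relations, and a word of length \<open>k\<close> takes the constant series \<open>1\<close> to its own monomial up to
  terms of degree below \<open>k\<close>; so a tensor in the ideal has vanishing top symmetric part
  (\<open>sym_part_weyl_ideal\<close>).

  Two solutions that are linear on generators have the same symbols on them and
  hence agree on them.  Together with \<open>\<complex>[[\<hbar>]]\<close> the generators produce every finite series, and by the
  growth condition in the completion every series is, for each \<open>N\<close>, a finite one plus \<open>\<hbar>\<^sup>N\<close> times an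
  element of the algebra.  As the maps commute with \<open>\<hbar>\<close>, they agree modulo all powers of \<open>\<hbar>\<close>
  (\<open>rees_alg_iso_eqI\<close>).
\<close>

section \<open>Equivariance of \<open>\<eta>\<close> and \<open>\<epsilon>\<close>\<close>

text \<open>
  The sign at infinity is what makes the identities below hold without exceptional cases.
\<close>

fun hom_coords :: "cp1 \<Rightarrow> complex \<times> complex" where
  "hom_coords (Fin z) = (z, 1)"
| "hom_coords Infty = (-1, 0)"

text \<open>
  The action of the adjugate matrix, which for determinant one is the inverse of \<open>g\<close>.
\<close>

definition inv_apply :: "complex^2^2 \<Rightarrow> complex \<times> complex \<Rightarrow> complex \<times> complex" where
  "inv_apply g = (\<lambda>(x, y). (g$2$2 * x - g$1$2 * y, g$1$1 * y - g$2$1 * x))"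

definition area :: "complex \<times> complex \<Rightarrow> complex \<times> complex \<Rightarrow> complex" where
  "area = (\<lambda>(x, y) (x', y'). x * y' - y * x')"

lemma SL2_det: "g \<in> SL2 \<Longrightarrow> g$1$1 * g$2$2 - g$1$2 * g$2$1 = 1"
  by (simp add: SL2_def det_2)

lemma SL2_mult: "g \<in> SL2 \<Longrightarrow> g' \<in> SL2 \<Longrightarrow> g ** g' \<in> SL2"
  by (simp add: SL2_def det_mul)

lemma eta_pt_nonzero:
  assumes "g \<in> SL2"
  shows "eta_pt g p \<noteq> 0"
proof (cases p)
  case (Fin z)
  have "g$1$2 - g$2$2 * z \<noteq> 0" if "g$1$1 = g$2$1 * z"
  proof
    assume "g$1$2 - g$2$2 * z = 0"
    then have "g$1$1 * g$2$2 - g$1$2 * g$2$1 = 0"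
      using that by (simp add: algebra_simps)
    then show False
      using SL2_det [OF assms] by simp
  qed
  then show ?thesis
    using Fin by simp
next
  case Infty
  then show ?thesis
    using SL2_det [OF assms] by auto
qed

text \<open>
  The factor \<open>\<eta>\<close> is the automorphy factor of the chosen section \<open>hom_coords\<close> of \<open>\<complex>\<^sup>2 - 0 \<rightarrow> \<complex>P\<^sup>1\<close>; this is
  the uniform description of its four cases.
\<close>

lemma inv_apply_hom_coords:
  assumes "g \<in> SL2"
  shows "inv_apply g (hom_coords p) =
    (inverse (eta_pt g p) * fst (hom_coords (mobius g p)),
     inverse (eta_pt g p) * snd (hom_coords (mobius g p)))"
proof (cases p)
  case (Fin z)
  show ?thesis
  proof (cases "g$1$1 - g$2$1 * z = 0")
    case True
    then show ?thesis
      using Fin by (simp add: inv_apply_def)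
  next
    case False
    then show ?thesis
      using Fin by (simp add: inv_apply_def)
  qed
next
  case Infty
  have "g$2$2 = inverse (g$1$1)" if "g$2$1 = 0"
    using SL2_det [OF assms] that by (metis diff_zero inverse_unique mult_zero_right)
  then show ?thesis
    using Infty by (simp add: inv_apply_def)
qed

lemma inv_apply_mult: "inv_apply (g ** g') v = inv_apply g' (inv_apply g v)"
  by (cases v) (simp add: inv_apply_def matrix_matrix_mult_def sum_2 algebra_simps)

lemma inv_apply_scale:
  "inv_apply g (k * x, k * y) = (k * fst (inv_apply g (x, y)), k * snd (inv_apply g (x, y)))"
  by (simp add: inv_apply_def algebra_simps)

text \<open>
  Each line contains only one representative, so both the point and the scalar can be
  read off a nonzero multiple of it.
\<close>

lemma hom_coords_proportional:
  assumes "(k * fst (hom_coords p), k * snd (hom_coords p)) = (l * fst (hom_coords q), l * snd (hom_coords q))"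
    and "k \<noteq> 0" "l \<noteq> 0"
  shows "p = q \<and> k = l"
  using assms by (cases p; cases q) auto

lemma mobius_eta_mult:
  assumes "g \<in> SL2" "g' \<in> SL2"
  shows "mobius (g ** g') p = mobius g' (mobius g p)"
    and "eta_pt (g ** g') p = eta_pt g p * eta_pt g' (mobius g p)"
proof -
  have "inv_apply (g ** g') (hom_coords p) =
    (inverse (eta_pt g p * eta_pt g' (mobius g p)) * fst (hom_coords (mobius g' (mobius g p))),
     inverse (eta_pt g p * eta_pt g' (mobius g p)) * snd (hom_coords (mobius g' (mobius g p))))"
    using inv_apply_hom_coords [OF assms(1), of p] inv_apply_hom_coords [OF assms(2), of "mobius g p"]
    by (simp add: inv_apply_mult inv_apply_scale)
  then have "mobius (g ** g') p = mobius g' (mobius g p) \<and>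
      inverse (eta_pt (g ** g') p) = inverse (eta_pt g p * eta_pt g' (mobius g p))"
    unfolding inv_apply_hom_coords [OF SL2_mult [OF assms]]
    using assms by (intro hom_coords_proportional) (simp_all add: eta_pt_nonzero SL2_mult)
  then show "mobius (g ** g') p = mobius g' (mobius g p)"
    and "eta_pt (g ** g') p = eta_pt g p * eta_pt g' (mobius g p)"
    by (simp_all del: inverse_mult_distrib)
qed

lemma eps_pt_eq_inverse_area: "eps_pt p q = inverse (area (hom_coords p) (hom_coords q))"
  by (cases p; cases q) (simp_all add: area_def field_simps)

lemma area_inv_apply:
  assumes "g \<in> SL2"
  shows "area (inv_apply g u) (inv_apply g v) = area u v"
proof -
  have "area (inv_apply g u) (inv_apply g v) = (g$1$1 * g$2$2 - g$1$2 * g$2$1) * area u v"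
    by (cases u; cases v) (simp add: area_def inv_apply_def algebra_simps)
  then show ?thesis
    using SL2_det [OF assms] by simp
qed

text \<open>
  Since \<open>\<epsilon>\<^sup>-\<^sup>1\<close> is the area spanned by the representatives, only the two automorphy factors
  survive when \<open>g\<^sup>-\<^sup>1\<close> is applied to both of them.
\<close>

lemma eps_pt_mobius:
  assumes "g \<in> SL2"
  shows "eps_pt p q = eta_pt g p * eta_pt g q * eps_pt (mobius g p) (mobius g q)"
proof -
  have "area (hom_coords p) (hom_coords q) = area (inv_apply g (hom_coords p)) (inv_apply g (hom_coords q))"
    by (simp add: area_inv_apply assms)
  also have "\<dots> = inverse (eta_pt g p) * inverse (eta_pt g q) *
      area (hom_coords (mobius g p)) (hom_coords (mobius g q))"
    by (simp add: inv_apply_hom_coords assms) (simp add: area_def case_prod_unfold algebra_simps)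
  finally show ?thesis
    by (simp add: eps_pt_eq_inverse_area)
qed

lemma eps_pt_antisym: "eps_pt q p = - eps_pt p q"
  by (cases p; cases q) (simp_all add: divide_simps)

lemma act_mult: "g \<in> SL2 \<Longrightarrow> g' \<in> SL2 \<Longrightarrow> act a (g ** g') = act (act a g) g'"
  by (simp add: act_def mobius_eta_mult)

section \<open>Linear extension from words\<close>

lemma tensor_eq_sum_single: "t = (\<Sum>w\<in>Poly_Mapping.keys t. Poly_Mapping.single w (Poly_Mapping.lookup t w))"
proof (rule poly_mapping_eqI)
  fix v
  have "(\<Sum>w\<in>Poly_Mapping.keys t. Poly_Mapping.lookup (Poly_Mapping.single w (Poly_Mapping.lookup t w)) v) =
      (\<Sum>w\<in>Poly_Mapping.keys t. if w = v then Poly_Mapping.lookup t v else 0)"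
    by (intro sum.cong) (auto simp: lookup_single when_def)
  also have "\<dots> = Poly_Mapping.lookup t v"
    by (simp add: in_keys_iff)
  finally show "Poly_Mapping.lookup t v =
      Poly_Mapping.lookup (\<Sum>w\<in>Poly_Mapping.keys t. Poly_Mapping.single w (Poly_Mapping.lookup t w)) v"
    by (simp add: lookup_sum)
qed

lemma tensor_induct [case_names zero single add]:
  fixes t :: "'x tensor"
  assumes "P 0" "\<And>w c. P (Poly_Mapping.single w c)" "\<And>s t. P s \<Longrightarrow> P t \<Longrightarrow> P (s + t)"
  shows "P t"
proof -
  have "P (\<Sum>w\<in>A. Poly_Mapping.single w (Poly_Mapping.lookup t w))" if "finite A" for A
    using that by induction (auto intro: assms)
  then show ?thesis
    by (subst tensor_eq_sum_single) simp
qed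

definition linext :: "('x word \<Rightarrow> complex) \<Rightarrow> 'x tensor \<Rightarrow> complex" where
  "linext F t = (\<Sum>w\<in>Poly_Mapping.keys t. Poly_Mapping.lookup t w * F w)"

lemma linext_superset:
  assumes "finite A" "Poly_Mapping.keys t \<subseteq> A"
  shows "linext F t = (\<Sum>w\<in>A. Poly_Mapping.lookup t w * F w)"
  unfolding linext_def using assms by (intro sum.mono_neutral_left) (auto simp: in_keys_iff)

lemma linext_add [simp]: "linext F (s + t) = linext F s + linext F t"
proof -
  let ?A = "Poly_Mapping.keys s \<union> Poly_Mapping.keys t"
  have "linext F (s + t) = (\<Sum>w\<in>?A. Poly_Mapping.lookup (s + t) w * F w)"
    by (intro linext_superset) (auto simp: keys_add)
  moreover have "linext F s = (\<Sum>w\<in>?A. Poly_Mapping.lookup s w * F w)"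
      "linext F t = (\<Sum>w\<in>?A. Poly_Mapping.lookup t w * F w)"
    by (intro linext_superset; auto)+
  ultimately show ?thesis
    by (simp add: lookup_add distrib_right sum.distrib)
qed

lemma linext_0 [simp]: "linext F 0 = 0"
  by (simp add: linext_def)

lemma linext_single [simp]: "linext F (Poly_Mapping.single w c) = c * F w"
  by (simp add: linext_def)

lemma linext_diff: "linext F (s - t) = linext F s - linext F t"
  using linext_add [of F "s - t" t] by (simp add: algebra_simps)

lemma linext_uminus: "linext F (- t) = - linext F t"
  using linext_diff [of F 0 t] by simp

lemma linext_zero_fun: "linext (\<lambda>w. 0) t = 0"
  by (simp add: linext_def)

lemma letters_plus [simp]: "letters (v + w) = letters v @ letters w"
  by (simp add: plus_word_def)

lemma letters_0 [simp]: "letters 0 = []"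
  by (simp add: zero_word_def)

section \<open>Tensor algebra and Weyl algebra\<close>

lemma carrier_tens: "t \<in> carrier (tens J d) \<longleftrightarrow> (\<forall>w \<in> Poly_Mapping.keys t. set (letters w) \<subseteq> coords J d)"
  and tens_mult [simp]: "s \<otimes>\<^bsub>tens J d\<^esub> t = s * t"
  and tens_add [simp]: "s \<oplus>\<^bsub>tens J d\<^esub> t = s + t"
  and tens_one [simp]: "\<one>\<^bsub>tens J d\<^esub> = 1"
  and tens_zero [simp]: "\<zero>\<^bsub>tens J d\<^esub> = 0"
  by (simp_all add: tens_def)

lemma tens_le_iff:
  "t \<in> tens_le J d k \<longleftrightarrow> (\<forall>w \<in> Poly_Mapping.keys t. set (letters w) \<subseteq> coords J d \<and> wlen w \<le> k)"
  by (auto simp: tens_le_def carrier_tens)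

lemma tens_le_carrier: "t \<in> tens_le J d k \<Longrightarrow> t \<in> carrier (tens J d)"
  by (simp add: tens_le_def)

lemma tens_le_mono: "t \<in> tens_le J d k \<Longrightarrow> k \<le> l \<Longrightarrow> t \<in> tens_le J d l"
  by (auto simp: tens_le_iff)

lemma tens_le_0 [simp]: "0 \<in> tens_le J d k"
  by (simp add: tens_le_iff)

lemma tens_le_single:
  "set (letters w) \<subseteq> coords J d \<Longrightarrow> wlen w \<le> k \<Longrightarrow> Poly_Mapping.single w c \<in> tens_le J d k"
  by (simp add: tens_le_iff)

lemma tens_le_const [simp]: "Poly_Mapping.single 0 c \<in> tens_le J d k"
  by (simp add: tens_le_single)

lemma tens_le_1 [simp]: "1 \<in> tens_le J d k"
  using tens_le_const [of 1] by simp

lemma tens_le_add: "s \<in> tens_le J d k \<Longrightarrow> t \<in> tens_le J d k \<Longrightarrow> s + t \<in> tens_le J d k"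
  using keys_add [of s t] by (auto simp: tens_le_iff)

lemma tens_le_uminus: "t \<in> tens_le J d k \<Longrightarrow> - t \<in> tens_le J d k"
  by (simp add: tens_le_iff)

lemma tens_le_diff: "s \<in> tens_le J d k \<Longrightarrow> t \<in> tens_le J d k \<Longrightarrow> s - t \<in> tens_le J d k"
  using tens_le_add [of s J d k "- t"] by (simp add: tens_le_uminus)

lemma tens_le_mult: "s \<in> tens_le J d k \<Longrightarrow> t \<in> tens_le J d l \<Longrightarrow> s * t \<in> tens_le J d (k + l)"
  using keys_mult [of s t] by (fastforce simp: tens_le_iff)

lemma tens_le_sum: "(\<And>i. i \<in> A \<Longrightarrow> f i \<in> tens_le J d k) \<Longrightarrow> sum f A \<in> tens_le J d k"
  by (induction A rule: infinite_finite_induct) (auto intro: tens_le_add)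

lemma carrier_tens_0 [simp]: "0 \<in> carrier (tens J d)"
  and carrier_tens_1 [simp]: "1 \<in> carrier (tens J d)"
  by (simp_all add: carrier_tens)

lemma carrier_tens_add: "s \<in> carrier (tens J d) \<Longrightarrow> t \<in> carrier (tens J d) \<Longrightarrow> s + t \<in> carrier (tens J d)"
  using keys_add [of s t] by (auto simp: carrier_tens)

lemma carrier_tens_uminus: "t \<in> carrier (tens J d) \<Longrightarrow> - t \<in> carrier (tens J d)"
  by (simp add: carrier_tens)

lemma carrier_tens_mult: "s \<in> carrier (tens J d) \<Longrightarrow> t \<in> carrier (tens J d) \<Longrightarrow> s * t \<in> carrier (tens J d)"
  using keys_mult [of s t] by (fastforce simp: carrier_tens)

lemma carrier_tens_sum: "(\<And>i. i \<in> A \<Longrightarrow> f i \<in> carrier (tens J d)) \<Longrightarrow> sum f A \<in> carrier (tens J d)"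
  by (induction A rule: infinite_finite_induct) (simp_all add: carrier_tens_add)

lemma ring_tens: "ring (tens J d)"
proof (rule ringI)
  show "abelian_group (tens J d)"
  proof (rule abelian_groupI)
    fix t assume "t \<in> carrier (tens J d)"
    then have "- t \<in> carrier (tens J d)" "- t \<oplus>\<^bsub>tens J d\<^esub> t = \<zero>\<^bsub>tens J d\<^esub>"
      by (simp_all add: carrier_tens_uminus)
    then show "\<exists>s\<in>carrier (tens J d). s \<oplus>\<^bsub>tens J d\<^esub> t = \<zero>\<^bsub>tens J d\<^esub>"
      by blast
  qed (simp_all add: carrier_tens_add add_ac)
  show "monoid (tens J d)"
    by (rule monoidI) (simp_all add: carrier_tens_mult mult.assoc)
qed (simp_all add: algebra_simps)

lemma dual_bracket_relation_carrier:
  assumes "f \<in> dual J d" "h \<in> dual J d"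
  shows "f * h - h * f - Poly_Mapping.single 0 c \<in> carrier (tens J d)"
proof -
  have "f \<in> tens_le J d 1" "h \<in> tens_le J d 1"
    using assms by (auto simp: dual_def tens_le_def)
  then have "f * h - h * f - Poly_Mapping.single 0 c \<in> tens_le J d (1 + 1)"
    by (intro tens_le_diff tens_le_mult tens_le_const)
  then show ?thesis
    by (rule tens_le_carrier)
qed

lemma ideal_weyl_ideal: "ideal (weyl_ideal J d a) (tens J d)"
  unfolding weyl_ideal_def
  by (intro ring.genideal_ideal ring_tens) (auto intro: dual_bracket_relation_carrier)

text \<open>
  Through this homomorphism, all computations in the Weyl algebra are done on representatives in the
  tensor algebra.
\<close>

lemma weyl_class_ring_hom: "weyl_class J d a \<in> ring_hom (tens J d) (weyl J d a)"
proof -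
  have "weyl_class J d a = (+>\<^bsub>tens J d\<^esub>) (weyl_ideal J d a)"
    by (simp add: weyl_class_def fun_eq_iff)
  then show ?thesis
    using ideal.rcos_ring_hom [OF ideal_weyl_ideal] by (simp add: weyl_def)
qed

lemma ring_weyl: "ring (weyl J d a)"
  unfolding weyl_def by (rule ideal.quotient_is_ring [OF ideal_weyl_ideal])

context
  fixes J :: "'j set" and d :: "'j \<Rightarrow> nat" and a :: "'j \<Rightarrow> cp1" and s t :: "'j coord tensor"
  assumes s: "s \<in> carrier (tens J d)" and t: "t \<in> carrier (tens J d)"
begin

lemma weyl_class_add: "weyl_class J d a s \<oplus>\<^bsub>weyl J d a\<^esub> weyl_class J d a t = weyl_class J d a (s + t)"
  using ring_hom_add [OF weyl_class_ring_hom s t] by simp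

lemma weyl_class_mult: "weyl_class J d a s \<otimes>\<^bsub>weyl J d a\<^esub> weyl_class J d a t = weyl_class J d a (s * t)"
  using ring_hom_mult [OF weyl_class_ring_hom s t] by simp

lemma weyl_class_eqD: "weyl_class J d a s = weyl_class J d a t \<Longrightarrow> s - t \<in> weyl_ideal J d a"
proof -
  interpret ideal "weyl_ideal J d a" "tens J d"
    by (rule ideal_weyl_ideal)
  assume "weyl_class J d a s = weyl_class J d a t"
  then have "s \<in> weyl_ideal J d a +>\<^bsub>tens J d\<^esub> t"
    using a_rcos_self [OF s] by (simp add: weyl_class_def)
  then obtain i where "i \<in> weyl_ideal J d a" "s = i + t"
    by (auto simp: a_r_coset_def')
  then show ?thesis
    by simp
qed

end

lemma weyl_class_closed: "t \<in> carrier (tens J d) \<Longrightarrow> weyl_class J d a t \<in> carrier (weyl J d a)"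
  by (rule ring_hom_closed [OF weyl_class_ring_hom])

lemma weyl_class_one: "\<one>\<^bsub>weyl J d a\<^esub> = weyl_class J d a 1"
  using ring_hom_one [OF weyl_class_ring_hom, of J d a] by simp

lemma weyl_class_zero: "\<zero>\<^bsub>weyl J d a\<^esub> = weyl_class J d a 0"
  using ring_hom_zero [OF weyl_class_ring_hom ring_tens ring_weyl, of J d a] by simp

text \<open>
  The coefficients of a product in the Rees algebra are finite sums of this form.
\<close>

lemma finsum_weyl_class:
  assumes "finite A" "\<And>i. i \<in> A \<Longrightarrow> f i \<in> carrier (tens J d)"
  shows "finsum (weyl J d a) (\<lambda>i. weyl_class J d a (f i)) A = weyl_class J d a (sum f A)"
proof -
  interpret W: ring "weyl J d a"
    by (rule ring_weyl)
  show ?thesis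
    using assms
  proof induction
    case empty
    then show ?case
      by (simp add: weyl_class_zero)
  next
    case (insert i A)
    then show ?case
      by (simp add: Pi_def weyl_class_closed weyl_class_add carrier_tens_sum)
  qed
qed

section \<open>Fock representation and independence of symbols\<close>

text \<open>
  A formal power series is given by its coefficient function on exponents.  Admitting all functions,
  and not just those of polynomials, avoids any side condition: creation and
  annihilation operators act on coefficients by finite formulas.
\<close>

type_synonym 'x fock = "('x \<Rightarrow> nat) \<Rightarrow> complex"

text \<open>
  Multiplication by the variable \<open>x\<close>, on coefficients.
\<close>

definition raise :: "'x \<Rightarrow> 'x fock \<Rightarrow> 'x fock" where
  "raise x p = (\<lambda>m. if m x = 0 then 0 else p (m(x := m x - 1)))"

text \<open>
  The partial derivative in \<open>x\<close>, on coefficients.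
\<close>

definition lower :: "'x \<Rightarrow> 'x fock \<Rightarrow> 'x fock" where
  "lower x p = (\<lambda>m. of_nat (m x + 1) * p (m(x := m x + 1)))"

lemma raise_raise: "raise x (raise y p) = raise y (raise x p)"
  by (auto simp: raise_def fun_eq_iff fun_upd_twist)

lemma lower_lower: "lower x (lower y p) = lower y (lower x p)"
  by (auto simp: lower_def fun_eq_iff fun_upd_twist)

lemma lower_raise: "lower x (raise y p) m = raise y (lower x p) m + (if x = y then p m else 0)"
proof -
  have "m(y := 0) = m" if "m y = 0"
    using that by auto
  then show ?thesis
    by (auto simp: lower_def raise_def fun_upd_twist algebra_simps of_nat_diff)
qed

text \<open>
  The only coordinate with which the given one can have a nonzero bracket.
\<close>

fun transposed :: "'j coord \<Rightarrow> 'j coord" where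
  "transposed (i, j, k, l) = (j, i, l, k)"

fun bracket_coeff :: "('j \<Rightarrow> cp1) \<Rightarrow> 'j coord \<Rightarrow> complex" where
  "bracket_coeff a (i, j, k, l) = inverse (eps a i j)"

lemma coord_bracket_eq: "coord_bracket a x y = (if transposed x = y then bracket_coeff a x else 0)"
  by (cases x; cases y) auto

lemma bracket_coeff_transposed: "bracket_coeff a (transposed x) = - bracket_coeff a x"
proof (cases x)
  case (fields i j k l)
  have "inverse (eps a j i) = - inverse (eps a i j)"
    unfolding eps_def by (subst eps_pt_antisym) (rule inverse_minus_eq)
  then show ?thesis
    using fields by simp
qed

lemma transposed_transposed [simp]: "transposed (transposed x) = x"
  by (cases x) simp

text \<open>
  Multiplication by \<open>x\<close> plus half of the derivation \<open>{x, -}\<close>.  In the commutator of two such operators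
  the two mixed terms contribute \<open>{x, y} / 2\<close> each.
\<close>

definition fock :: "('j \<Rightarrow> cp1) \<Rightarrow> 'j coord \<Rightarrow> 'j coord fock \<Rightarrow> 'j coord fock" where
  "fock a x p = (\<lambda>m. raise x p m + bracket_coeff a x / 2 * lower (transposed x) p m)"

lemma raise_lincomb: "raise x (\<lambda>m. p m + c * q m) = (\<lambda>m. raise x p m + c * raise x q m)"
  by (auto simp: raise_def)

lemma lower_lincomb: "lower x (\<lambda>m. p m + c * q m) = (\<lambda>m. lower x p m + c * lower x q m)"
  by (auto simp: lower_def algebra_simps)

lemma fock_lincomb: "fock a x (\<lambda>m. p m + c * q m) = (\<lambda>m. fock a x p m + c * fock a x q m)"
  by (auto simp: fock_def raise_lincomb lower_lincomb algebra_simps)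

lemma fock_0: "fock a x (\<lambda>m. 0) = (\<lambda>m. 0)"
  by (auto simp: fock_def raise_def lower_def)

lemma fock_commutator:
  "fock a x (fock a y p) m - fock a y (fock a x p) m = coord_bracket a x y * p m"
proof -
  have expand: "fock a x (fock a y p) m =
      raise x (raise y p) m + bracket_coeff a y / 2 * raise x (lower (transposed y) p) m
      + bracket_coeff a x / 2 * (lower (transposed x) (raise y p) m
      + bracket_coeff a y / 2 * lower (transposed x) (lower (transposed y) p) m)" for x y
    unfolding fock_def raise_lincomb lower_lincomb by simp
  have eq: "transposed y = x \<longleftrightarrow> transposed x = y"
    by auto
  show ?thesis
    unfolding expand coord_bracket_eq lower_raise eq
    unfolding raise_raise [of y x] lower_lower [of "transposed y" "transposed x"]
    by (cases "transposed x = y") (auto simp: bracket_coeff_transposed algebra_simps)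
qed

definition fock_word :: "('j \<Rightarrow> cp1) \<Rightarrow> 'j coord word \<Rightarrow> 'j coord fock \<Rightarrow> 'j coord fock" where
  "fock_word a w p = foldr (fock a) (letters w) p"

definition fock_tensor :: "('j \<Rightarrow> cp1) \<Rightarrow> 'j coord tensor \<Rightarrow> 'j coord fock \<Rightarrow> 'j coord fock" where
  "fock_tensor a t p = (\<lambda>m. linext (\<lambda>w. fock_word a w p m) t)"

lemma fock_word_lincomb:
  "fock_word a w (\<lambda>m. p m + c * q m) = (\<lambda>m. fock_word a w p m + c * fock_word a w q m)"
proof -
  have "foldr (fock a) xs (\<lambda>m. p m + c * q m) = (\<lambda>m. foldr (fock a) xs p m + c * foldr (fock a) xs q m)" for xs
    by (induction xs) (simp_all add: fock_lincomb)
  then show ?thesis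
    by (simp add: fock_word_def)
qed

lemma fock_word_0 [simp]: "fock_word a w (\<lambda>m. 0) = (\<lambda>m. 0)"
proof -
  have "foldr (fock a) xs (\<lambda>m. 0) = (\<lambda>m. 0)" for xs
    by (induction xs) (simp_all add: fock_0)
  then show ?thesis
    by (simp add: fock_word_def)
qed

lemma fock_word_plus: "fock_word a (v + w) p = fock_word a v (fock_word a w p)"
  by (simp add: fock_word_def)

lemma fock_tensor_0 [simp]: "fock_tensor a t (\<lambda>m. 0) = (\<lambda>m. 0)"
  by (simp add: fock_tensor_def linext_zero_fun)

lemma fock_tensor_mult: "fock_tensor a (s * t) p = fock_tensor a s (fock_tensor a t p)"
proof (induction t rule: tensor_induct)
  case zero
  then show ?case
    by (simp add: fock_tensor_def linext_zero_fun)
next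
  case (single w c)
  show ?case
  proof (induction s rule: tensor_induct)
    case (single v b)
    have "fock_word a v (\<lambda>m. c * fock_word a w p m) = (\<lambda>m. c * fock_word a v (fock_word a w p) m)"
      using fock_word_lincomb [of a v "\<lambda>m. 0"] by simp
    then show ?case
      by (simp add: fock_tensor_def mult_single fock_word_plus mult.assoc)
  qed (simp_all add: fock_tensor_def distrib_right fun_eq_iff)
next
  case (add t1 t2)
  have "fock_tensor a s (\<lambda>m. q m + r m) = (\<lambda>m. fock_tensor a s q m + fock_tensor a s r m)" for q r
    using fock_word_lincomb [of a _ q 1 r]
    by (simp add: fock_tensor_def linext_def distrib_left sum.distrib)
  with add show ?case
    by (simp add: fock_tensor_def distrib_left fun_eq_iff)
qed

lemma finite_coords: "finite J \<Longrightarrow> finite (coords J d)"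
proof -
  assume J: "finite J"
  have "coords J d \<subseteq> J \<times> J \<times> {..<Max (d ` J) + 1} \<times> {..<Max (d ` J) + 1}"
  proof
    fix x assume "x \<in> coords J d"
    moreover have "d i \<le> Max (d ` J)" if "i \<in> J" for i
      using J that by simp
    ultimately show "x \<in> J \<times> J \<times> {..<Max (d ` J) + 1} \<times> {..<Max (d ` J) + 1}"
      by (fastforce simp: coords_def)
  qed
  then show ?thesis
    by (rule finite_subset) (use J in simp)
qed

lemma dual_keys:
  assumes "f \<in> dual J d"
  shows "Poly_Mapping.keys f \<subseteq> (\<lambda>x. Word [x]) ` coords J d"
proof
  fix w assume w: "w \<in> Poly_Mapping.keys f"
  then have "set (letters w) \<subseteq> coords J d" "wlen w = 1"
    using assms by (auto simp: dual_def carrier_tens)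
  then show "w \<in> (\<lambda>x. Word [x]) ` coords J d"
    by (cases w) (auto simp: length_Suc_conv)
qed

lemma linext_dual:
  assumes "finite J" "f \<in> dual J d"
  shows "linext F f = (\<Sum>x\<in>coords J d. Poly_Mapping.lookup f (Word [x]) * F (Word [x]))"
proof -
  have "linext F f = (\<Sum>w\<in>(\<lambda>x. Word [x]) ` coords J d. Poly_Mapping.lookup f w * F w)"
    using assms by (intro linext_superset) (auto simp: finite_coords dest: dual_keys)
  then show ?thesis
    by (simp add: sum.reindex inj_on_def)
qed

lemma fock_word_sum:
  "fock_word a w (\<lambda>m. \<Sum>x\<in>A. c x * p x m) = (\<lambda>m. \<Sum>x\<in>A. c x * fock_word a w (p x) m)"
proof (induction A rule: infinite_finite_induct)
  case (insert x A)
  then show ?case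
    using fock_word_lincomb [of a w "\<lambda>m. \<Sum>x\<in>A. c x * p x m" "c x" "p x"]
    by (simp add: add.commute)
qed simp_all

lemma fock_tensor_dual_mult:
  assumes "finite J" "f \<in> dual J d" "h \<in> dual J d"
  shows "fock_tensor a (f * h) p m = (\<Sum>x\<in>coords J d. \<Sum>y\<in>coords J d.
    Poly_Mapping.lookup f (Word [x]) * Poly_Mapping.lookup h (Word [y]) * fock a x (fock a y p) m)"
  unfolding fock_tensor_mult unfolding fock_tensor_def linext_dual [OF assms(1,2)]
    linext_dual [OF assms(1,3)] fock_word_sum
  by (simp add: fock_word_def sum_distrib_left mult.assoc)

lemma fock_tensor_relation:
  assumes "finite J" "f \<in> dual J d" "h \<in> dual J d"
  shows "fock_tensor a (f * h - h * f - Poly_Mapping.single 0 (dual_bracket J d a f h)) p m = 0"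
proof -
  let ?C = "coords J d" and ?f = "\<lambda>x. Poly_Mapping.lookup f (Word [x])"
    and ?h = "\<lambda>x. Poly_Mapping.lookup h (Word [x])"
  have "fock_tensor a (h * f) p m = (\<Sum>x\<in>?C. \<Sum>y\<in>?C. ?f x * ?h y * fock a y (fock a x p) m)"
    unfolding fock_tensor_dual_mult [OF assms(1,3,2)]
    by (subst sum.swap) (simp add: mult_ac)
  then have "fock_tensor a (f * h) p m - fock_tensor a (h * f) p m =
      (\<Sum>x\<in>?C. \<Sum>y\<in>?C. ?f x * ?h y * (fock a x (fock a y p) m - fock a y (fock a x p) m))"
    unfolding fock_tensor_dual_mult [OF assms] by (simp add: sum_subtractf right_diff_distrib)
  also have "\<dots> = dual_bracket J d a f h * p m"
    unfolding fock_commutator dual_bracket_def by (simp add: sum_distrib_right mult.assoc)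
  finally show ?thesis
    by (simp add: fock_tensor_def linext_diff fock_word_def)
qed

text \<open>
  The annihilator of the whole representation is a two-sided ideal, and it contains the defining
  relations.
\<close>

lemma fock_tensor_weyl_ideal:
  assumes "finite J" "t \<in> weyl_ideal J d a"
  shows "fock_tensor a t p = (\<lambda>m. 0)"
proof -
  let ?K = "{t \<in> carrier (tens J d). \<forall>p. fock_tensor a t p = (\<lambda>m. 0)}"
  interpret T: ring "tens J d"
    by (rule ring_tens)
  have "ideal ?K (tens J d)"
  proof (rule idealI)
    show "subgroup ?K (add_monoid (tens J d))"
    proof (rule T.add.subgroupI)
      fix t assume "t \<in> ?K"
      then have "t \<in> carrier (tens J d)" "- t \<in> ?K"
        by (auto simp: carrier_tens_uminus fock_tensor_def linext_uminus fun_eq_iff)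
      moreover from this have "\<ominus>\<^bsub>tens J d\<^esub> t = - t"
        by (intro T.minus_equality) (auto simp: carrier_tens_uminus)
      ultimately show "\<ominus>\<^bsub>tens J d\<^esub> t \<in> ?K"
        by simp
    next
      have "0 \<in> ?K"
        by (simp add: fock_tensor_def)
      then show "?K \<noteq> {}"
        by blast
    qed (auto simp: carrier_tens_add fock_tensor_def fun_eq_iff)
  qed (auto simp: carrier_tens_mult fock_tensor_mult ring_tens)
  moreover have "{f * h - h * f - Poly_Mapping.single 0 (dual_bracket J d a f h) | f h.
      f \<in> dual J d \<and> h \<in> dual J d} \<subseteq> ?K"
    using assms(1) by (auto simp: dual_bracket_relation_carrier fock_tensor_relation fun_eq_iff)
  ultimately have "weyl_ideal J d a \<subseteq> ?K"
    unfolding weyl_ideal_def by (rule T.genideal_minimal)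
  then show ?thesis
    using assms(2) by blast
qed

definition vacuum :: "'x fock" where
  "vacuum = (\<lambda>m. if m = (\<lambda>x. 0) then 1 else 0)"

lemma sum_fun_upd_Suc:
  assumes "finite C" "x \<in> C"
  shows "(\<Sum>y\<in>C. (m(x := Suc (m x))) y) = Suc (\<Sum>y\<in>C. m y)"
proof -
  have "(\<Sum>y\<in>C. (m(x := Suc (m x))) y) = (\<Sum>y\<in>C. m y + (if y = x then 1 else 0))"
    by (intro sum.cong) auto
  then show ?thesis
    using assms by (simp add: sum.distrib)
qed

lemma transposed_coords: "x \<in> coords J d \<Longrightarrow> transposed x \<in> coords J d"
  by (cases x) (auto simp: coords_def)

text \<open>
  Each letter raises the degree by one in its first term and lowers it in its second, so in degree
  at least the number of letters only the product of all first terms remains.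
\<close>

lemma fock_vacuum_top:
  assumes "finite J" "set xs \<subseteq> coords J d" "length xs \<le> (\<Sum>x\<in>coords J d. m x)"
  shows "foldr (fock a) xs vacuum m = (if m = count_list xs then 1 else 0)"
  using assms(2,3)
proof (induction xs arbitrary: m)
  case Nil
  then show ?case
    by (simp add: vacuum_def fun_eq_iff)
next
  case (Cons x xs)
  note C = finite_coords [OF assms(1), of d]
  have x: "x \<in> coords J d" "transposed x \<in> coords J d" and xs: "set xs \<subseteq> coords J d"
    using Cons.prems by (auto intro: transposed_coords)
  let ?q = "foldr (fock a) xs vacuum" and ?n = "m(transposed x := Suc (m (transposed x)))"
  have "length xs = (\<Sum>y\<in>coords J d. count_list xs y)"
    using C xs by (metis sum_count_set)
  moreover have "Suc (length xs) < (\<Sum>y\<in>coords J d. ?n y)"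
    using sum_fun_upd_Suc [OF C x(2), of m] Cons.prems by simp
  ultimately have "length xs \<le> (\<Sum>y\<in>coords J d. ?n y)" "?n \<noteq> count_list xs"
    by (linarith, metis not_less_iff_gr_or_eq Suc_lessD)
  then have "?q ?n = 0"
    by (simp only: Cons.IH [OF xs] if_False)
  then have low: "lower (transposed x) ?q m = 0"
    by (simp add: lower_def)
  have "raise x ?q m = (if m = count_list (x # xs) then 1 else 0)"
  proof (cases "m x")
    case 0
    then have "m \<noteq> count_list (x # xs)"
      by (metis count_list.simps(2) add_is_0 one_neq_zero)
    then show ?thesis
      using 0 by (simp add: raise_def)
  next
    case (Suc k)
    let ?m = "m(x := k)"
    have m: "m = ?m(x := Suc (?m x))"
      using Suc by auto
    have "(\<Sum>y\<in>coords J d. m y) = Suc (\<Sum>y\<in>coords J d. ?m y)"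
      using sum_fun_upd_Suc [OF C x(1), of ?m] by (simp only: m [symmetric])
    then have "length xs \<le> (\<Sum>y\<in>coords J d. ?m y)"
      using Cons.prems(2) by (simp only: list.size Suc_le_mono add_Suc_right add_0_right)
    then have "?q ?m = (if ?m = count_list xs then 1 else 0)"
      by (rule Cons.IH [OF xs])
    moreover have "?m = count_list xs \<longleftrightarrow> m = count_list (x # xs)"
      using Suc by (auto simp: fun_eq_iff split: if_splits)
    ultimately show ?thesis
      using Suc by (simp add: raise_def)
  qed
  moreover have "foldr (fock a) (x # xs) vacuum m =
      raise x ?q m + bracket_coeff a x / 2 * lower (transposed x) ?q m"
    unfolding foldr.simps o_apply fock_def [of a x] by (rule refl)
  ultimately show ?case
    using low by (simp only: mult_zero_right add_0_right)
qed

lemma prod_list_count: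
  fixes B :: "'x \<Rightarrow> complex"
  assumes "finite C" "set xs \<subseteq> C"
  shows "prod_list (map B xs) = (\<Prod>x\<in>C. B x ^ count_list xs x)"
  using assms(2)
proof (induction xs)
  case (Cons x xs)
  have "(\<Prod>y\<in>C. B y ^ count_list (x # xs) y) = (\<Prod>y\<in>C. (if y = x then B x else 1) * B y ^ count_list xs y)"
    by (intro prod.cong) auto
  also have "\<dots> = B x * (\<Prod>y\<in>C. B y ^ count_list xs y)"
    using assms(1) Cons.prems by (simp add: prod.distrib)
  finally show ?case
    using Cons by simp
qed simp

lemma sym_part_linext:
  "B \<in> rep_space J d \<Longrightarrow>
    sym_part J d k t B = linext (\<lambda>w. if wlen w = k then prod_list (map B (letters w)) else 0) t"
  by (simp add: sym_part_def linext_def if_distrib sum.inter_filter cong: if_cong)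

text \<open>
  The top coefficients of the action on the constant series \<open>1\<close> are the sums of the coefficients of
  \<open>t\<close> over all words with the same letter counts, which are exactly the coefficients of the
  polynomial \<open>sym_part J d k t\<close>.
\<close>

lemma sym_part_weyl_ideal:
  assumes "finite J" "t \<in> tens_le J d k" "t \<in> weyl_ideal J d a" "B \<in> rep_space J d"
  shows "sym_part J d k t B = 0"
proof -
  let ?W = "{w \<in> Poly_Mapping.keys t. wlen w = k}"
  let ?c = "\<lambda>w. count_list (letters w)"
  have C: "finite (coords J d)"
    using assms(1) by (rule finite_coords)
  have keys: "set (letters w) \<subseteq> coords J d" "wlen w \<le> k" if "w \<in> Poly_Mapping.keys t" for w
    using assms(2) that by (auto simp: tens_le_iff)
  have deg: "(\<Sum>x\<in>coords J d. ?c w x) = wlen w" if "w \<in> Poly_Mapping.keys t" for w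
    using keys(1) [OF that] C by (metis sum_count_set)
  have coeff: "(\<Sum>w | w \<in> ?W \<and> ?c w = m. Poly_Mapping.lookup t w) = 0" if "m \<in> ?c ` ?W" for m
  proof -
    have m: "(\<Sum>x\<in>coords J d. m x) = k"
      using that deg by auto
    have top: "foldr (fock a) (letters w) vacuum m = (if ?c w = m then 1 else 0)"
      if "w \<in> Poly_Mapping.keys t" for w
      using fock_vacuum_top [OF assms(1) keys(1) [OF that], of m] keys(2) [OF that] m by auto
    have "0 = fock_tensor a t vacuum m"
      by (simp add: fock_tensor_weyl_ideal [OF assms(1,3)])
    also have "\<dots> = (\<Sum>w\<in>Poly_Mapping.keys t. Poly_Mapping.lookup t w * (if ?c w = m then 1 else 0))"
      unfolding fock_tensor_def linext_def fock_word_def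
      by (intro sum.cong) (simp_all add: top)
    also have "\<dots> = (\<Sum>w | w \<in> Poly_Mapping.keys t \<and> ?c w = m. Poly_Mapping.lookup t w)"
      by (simp add: sum.inter_filter if_distrib cong: if_cong)
    also have "{w. w \<in> Poly_Mapping.keys t \<and> ?c w = m} = {w. w \<in> ?W \<and> ?c w = m}"
      using deg m by auto
    finally show ?thesis
      by simp
  qed
  have "sym_part J d k t B = (\<Sum>w\<in>?W. Poly_Mapping.lookup t w * (\<Prod>x\<in>coords J d. B x ^ ?c w x))"
    using assms(4) keys C by (auto simp: sym_part_def prod_list_count intro!: sum.cong)
  also have "\<dots> = (\<Sum>m\<in>?c ` ?W.
      \<Sum>w | w \<in> ?W \<and> ?c w = m. Poly_Mapping.lookup t w * (\<Prod>x\<in>coords J d. B x ^ ?c w x))"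
    by (rule sum.image_gen) simp
  also have "\<dots> = (\<Sum>m\<in>?c ` ?W.
      (\<Sum>w | w \<in> ?W \<and> ?c w = m. Poly_Mapping.lookup t w) * (\<Prod>x\<in>coords J d. B x ^ m x))"
    by (intro sum.cong) (auto simp: sum_distrib_right)
  also have "\<dots> = 0"
    using coeff by simp
  finally show ?thesis .
qed

text \<open>
  Two representatives differ by an element of the ideal, so exactly one function satisfies the
  description of the symbol.
\<close>

lemma symb_weyl_class:
  assumes "finite J" "t \<in> tens_le J d k"
  shows "symb J d a k (weyl_class J d a t) = sym_part J d k t"
  unfolding symb_def
proof (rule the_equality)
  show "\<exists>s\<in>tens_le J d k. weyl_class J d a t = weyl_class J d a s \<and> sym_part J d k t = sym_part J d k s"
    using assms(2) by blast
next
  fix p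
  assume "\<exists>s\<in>tens_le J d k. weyl_class J d a t = weyl_class J d a s \<and> p = sym_part J d k s"
  then obtain s where s: "s \<in> tens_le J d k" "weyl_class J d a t = weyl_class J d a s" "p = sym_part J d k s"
    by blast
  have "s - t \<in> weyl_ideal J d a"
    using s assms(2) by (intro weyl_class_eqD) (auto intro: tens_le_carrier)
  then have "sym_part J d k (s - t) B = 0" if "B \<in> rep_space J d" for B
    using that s assms by (intro sym_part_weyl_ideal) (auto intro: tens_le_diff)
  then have "sym_part J d k s B = sym_part J d k t B" if "B \<in> rep_space J d" for B
    using that by (simp add: sym_part_linext linext_diff)
  moreover have "sym_part J d k s B = sym_part J d k t B" if "B \<notin> rep_space J d" for B
    using that by (simp add: sym_part_def)
  ultimately show "p = sym_part J d k t"
    using s(3) by blast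
qed

section \<open>Rescaling the letters\<close>

definition dilate :: "('x \<Rightarrow> complex) \<Rightarrow> 'x tensor \<Rightarrow> 'x tensor" where
  "dilate c = Poly_Mapping.mapp (\<lambda>w z. prod_list (map c (letters w)) * z)"

lemma lookup_dilate:
  "Poly_Mapping.lookup (dilate c t) w = prod_list (map c (letters w)) * Poly_Mapping.lookup t w"
  by (simp add: dilate_def lookup_mapp when_def in_keys_iff)

lemma keys_dilate_subset: "Poly_Mapping.keys (dilate c t) \<subseteq> Poly_Mapping.keys t"
  by (auto simp: in_keys_iff lookup_dilate)

lemma dilate_add: "dilate c (s + t) = dilate c s + dilate c t"
  by (rule poly_mapping_eqI) (simp add: lookup_dilate lookup_add distrib_left)

lemma dilate_diff: "dilate c (s - t) = dilate c s - dilate c t"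
  by (rule poly_mapping_eqI) (simp add: lookup_dilate lookup_minus right_diff_distrib)

lemma dilate_0 [simp]: "dilate c 0 = 0"
  by (rule poly_mapping_eqI) (simp add: lookup_dilate)

lemma dilate_single:
  "dilate c (Poly_Mapping.single w z) = Poly_Mapping.single w (prod_list (map c (letters w)) * z)"
  by (rule poly_mapping_eqI) (simp add: lookup_dilate lookup_single when_def)

lemma dilate_const [simp]: "dilate c (Poly_Mapping.single 0 z) = Poly_Mapping.single 0 z"
  by (simp add: dilate_single)

lemma dilate_1 [simp]: "dilate c 1 = 1"
  using dilate_const [of c 1] by simp

lemma dilate_sum: "dilate c (sum f A) = (\<Sum>i\<in>A. dilate c (f i))"
  by (induction A rule: infinite_finite_induct) (simp_all add: dilate_add)

lemma dilate_mult: "dilate c (s * t) = dilate c s * dilate c t"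
proof (induction t rule: tensor_induct)
  case (single w z)
  show ?case
    by (induction s rule: tensor_induct)
      (simp_all add: mult_single dilate_single dilate_add distrib_right mult_ac)
qed (simp_all add: dilate_add distrib_left)

lemma dilate_dilate: "dilate c (dilate b t) = dilate (\<lambda>x. c x * b x) t"
proof -
  have "prod_list (map (\<lambda>x. c x * b x) xs) = prod_list (map c xs) * prod_list (map b xs)" for xs
    by (induction xs) simp_all
  then show ?thesis
    by (intro poly_mapping_eqI) (simp add: lookup_dilate mult.assoc)
qed

lemma dilate_one: "dilate (\<lambda>x. 1) t = t"
  by (intro poly_mapping_eqI) (simp add: lookup_dilate map_replicate_const)

lemma dilate_inverse: "(\<And>x. c x \<noteq> 0) \<Longrightarrow> dilate c (dilate (\<lambda>x. inverse (c x)) t) = t"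
  by (simp add: dilate_dilate dilate_one)

lemma carrier_tens_dilate: "t \<in> carrier (tens J d) \<Longrightarrow> dilate c t \<in> carrier (tens J d)"
  using keys_dilate_subset by (fastforce simp: carrier_tens)

lemma tens_le_dilate: "t \<in> tens_le J d k \<Longrightarrow> dilate c t \<in> tens_le J d k"
  using keys_dilate_subset [of c t] unfolding tens_le_iff by blast

lemma dual_dilate: "t \<in> dual J d \<Longrightarrow> dilate c t \<in> dual J d"
  using keys_dilate_subset [of c t] by (auto simp: dual_def carrier_tens_dilate)

text \<open>
  The linear map \<open>x \<mapsto> c(x) x\<close> is invertible and takes the Poisson bracket for \<open>b\<close> to the one for \<open>a\<close>.
\<close>

definition poisson_scaling ::
  "'j set \<Rightarrow> ('j \<Rightarrow> nat) \<Rightarrow> ('j \<Rightarrow> cp1) \<Rightarrow> ('j \<Rightarrow> cp1) \<Rightarrow> ('j coord \<Rightarrow> complex) \<Rightarrow> bool" where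
  "poisson_scaling J d b a c \<longleftrightarrow> (\<forall>x. c x \<noteq> 0) \<and>
    (\<forall>x\<in>coords J d. \<forall>y\<in>coords J d. c x * c y * coord_bracket a x y = coord_bracket b x y)"

lemma poisson_nonzero: "poisson_scaling J d b a c \<Longrightarrow> c x \<noteq> 0"
  unfolding poisson_scaling_def by blast

lemma poisson_bracket:
  "poisson_scaling J d b a c \<Longrightarrow> x \<in> coords J d \<Longrightarrow> y \<in> coords J d \<Longrightarrow>
    coord_bracket b x y = c x * c y * coord_bracket a x y"
  unfolding poisson_scaling_def by simp

lemma poisson_inverse:
  assumes "poisson_scaling J d b a c"
  shows "poisson_scaling J d a b (\<lambda>x. inverse (c x))"
proof -
  have "inverse (c x) * inverse (c y) * coord_bracket b x y = coord_bracket a x y"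
    if "x \<in> coords J d" "y \<in> coords J d" for x y
    using that by (simp add: poisson_bracket [OF assms] poisson_nonzero [OF assms] field_simps)
  then show ?thesis
    unfolding poisson_scaling_def by (simp add: poisson_nonzero [OF assms])
qed

lemma dual_bracket_dilate:
  assumes "poisson_scaling J d b a c"
  shows "dual_bracket J d a (dilate c f) (dilate c h) = dual_bracket J d b f h"
  unfolding dual_bracket_def
proof (intro sum.cong refl)
  fix x y
  assume "x \<in> coords J d" "y \<in> coords J d"
  then have "coord_bracket b x y = c x * c y * coord_bracket a x y"
    by (rule poisson_bracket [OF assms])
  then show "Poly_Mapping.lookup (dilate c f) (Word [x]) * Poly_Mapping.lookup (dilate c h) (Word [y]) *
      coord_bracket a x y =
    Poly_Mapping.lookup f (Word [x]) * Poly_Mapping.lookup h (Word [y]) * coord_bracket b x y"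
    by (simp add: lookup_dilate)
qed

text \<open>
  The rescaling takes the relation of \<open>f\<close> and \<open>h\<close> to the relation of their rescalings, so the preimage
  of the one ideal contains the generators of the other.
\<close>

lemma dilate_weyl_ideal_subset:
  assumes "poisson_scaling J d b a c" "t \<in> weyl_ideal J d b"
  shows "dilate c t \<in> weyl_ideal J d a"
proof -
  let ?gens = "\<lambda>a. {f * h - h * f - Poly_Mapping.single 0 (dual_bracket J d a f h) | f h.
      f \<in> dual J d \<and> h \<in> dual J d}"
  let ?K = "{t \<in> carrier (tens J d). dilate c t \<in> weyl_ideal J d a}"
  interpret T: ring "tens J d"
    by (rule ring_tens)
  interpret I: ideal "weyl_ideal J d a" "tens J d"
    by (rule ideal_weyl_ideal)
  have "dilate c \<in> ring_hom (tens J d) (tens J d)"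
    by (rule ring_hom_memI) (simp_all add: carrier_tens_dilate dilate_mult dilate_add)
  then have "ring_hom_ring (tens J d) (tens J d) (dilate c)"
    by (intro ring_hom_ringI2 ring_tens)
  then have "ideal ?K (tens J d)"
    using ring_hom_ring.ideal_vimage ideal_weyl_ideal by blast
  moreover have "?gens b \<subseteq> ?K"
  proof
    fix r assume "r \<in> ?gens b"
    then obtain f h where fh: "f \<in> dual J d" "h \<in> dual J d"
        and r: "r = f * h - h * f - Poly_Mapping.single 0 (dual_bracket J d b f h)"
      by blast
    have "dilate c r = dilate c f * dilate c h - dilate c h * dilate c f
        - Poly_Mapping.single 0 (dual_bracket J d a (dilate c f) (dilate c h))"
      by (simp add: r dilate_diff dilate_mult dual_bracket_dilate [OF assms(1)])
    then have "dilate c r \<in> ?gens a"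
      using fh by (blast intro: dual_dilate)
    moreover have "?gens a \<subseteq> carrier (tens J d)"
      by (auto intro: dual_bracket_relation_carrier)
    ultimately show "r \<in> ?K"
      using T.genideal_self [of "?gens a"] fh
      by (auto simp: r weyl_ideal_def dual_bracket_relation_carrier)
  qed
  ultimately have "weyl_ideal J d b \<subseteq> ?K"
    unfolding weyl_ideal_def by (rule T.genideal_minimal)
  then show ?thesis
    using assms(2) by blast
qed

text \<open>
  Since the inverse rescaling also respects the ideals, the image of a coset is an entire coset.
  This lets the map of Weyl algebras be the image operation on cosets.
\<close>

lemma dilate_weyl_class:
  assumes "poisson_scaling J d b a c"
  shows "dilate c ` weyl_class J d b t = weyl_class J d a (dilate c t)"
proof -
  have "\<exists>u\<in>weyl_ideal J d b. dilate c (u + t) = v + dilate c t" if "v \<in> weyl_ideal J d a" for v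
  proof -
    let ?u = "dilate (\<lambda>x. inverse (c x)) v"
    have "?u \<in> weyl_ideal J d b"
      using that by (rule dilate_weyl_ideal_subset [OF poisson_inverse [OF assms]])
    moreover have "dilate c ?u = v"
      using poisson_nonzero [OF assms] by (rule dilate_inverse)
    ultimately show ?thesis
      by (metis dilate_add)
  qed
  then show ?thesis
    using dilate_weyl_ideal_subset [OF assms]
    by (fastforce simp: weyl_class_def a_r_coset_def' dilate_add image_iff)
qed

lemma sym_part_dilate:
  assumes "B \<in> rep_space J d" "(\<lambda>x. c x * B x) \<in> rep_space J d"
  shows "sym_part J d k (dilate c t) B = sym_part J d k t (\<lambda>x. c x * B x)"
proof -
  have *: "prod_list (map (\<lambda>x. c x * B x) xs) = prod_list (map c xs) * prod_list (map B xs)" for xs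
    by (induction xs) simp_all
  have "linext F (dilate c t) = linext (\<lambda>w. prod_list (map c (letters w)) * F w) t" for F
    by (subst linext_superset [OF finite_keys keys_dilate_subset])
      (simp add: linext_def lookup_dilate mult_ac)
  then show ?thesis
    using assms by (simp add: sym_part_linext * if_distrib cong: if_cong)
qed

section \<open>Representatives of the completed Rees algebra\<close>

definition rees_class :: "'j set \<Rightarrow> ('j \<Rightarrow> nat) \<Rightarrow> ('j \<Rightarrow> cp1) \<Rightarrow> (nat \<Rightarrow> 'j coord tensor) \<Rightarrow>
    nat \<Rightarrow> 'j coord tensor set" where
  "rees_class J d a t = (\<lambda>k. weyl_class J d a (t k))"

text \<open>
  Coefficientwise representatives of the elements of the completed Rees algebra.  The second
  condition expresses the growth condition on \<open>k - |f\<^sub>k|\<close> through the word length of representatives;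
  the conjunct \<open>N \<le> k\<close> guards against truncated subtraction.
\<close>

definition rees_seqs :: "'j set \<Rightarrow> ('j \<Rightarrow> nat) \<Rightarrow> (nat \<Rightarrow> 'j coord tensor) set" where
  "rees_seqs J d = {t. (\<forall>k. t k \<in> tens_le J d k) \<and>
     (\<forall>N. \<forall>\<^sub>F k in sequentially. N \<le> k \<and> t k \<in> tens_le J d (k - N))}"

definition cauchy_prod :: "(nat \<Rightarrow> 'x tensor) \<Rightarrow> (nat \<Rightarrow> 'x tensor) \<Rightarrow> nat \<Rightarrow> 'x tensor" where
  "cauchy_prod s t = (\<lambda>k. \<Sum>i\<le>k. s i * t (k - i))"

lemma rees_seqs_le: "t \<in> rees_seqs J d \<Longrightarrow> t k \<in> tens_le J d k"
  by (simp add: rees_seqs_def)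

lemma rees_seqs_carrier: "t \<in> rees_seqs J d \<Longrightarrow> t k \<in> carrier (tens J d)"
  by (auto intro: tens_le_carrier rees_seqs_le)

lemma rees_seqs_eventually:
  assumes "t \<in> rees_seqs J d"
  obtains K where "\<And>k. K \<le> k \<Longrightarrow> N \<le> k \<and> t k \<in> tens_le J d (k - N)"
  using assms unfolding rees_seqs_def eventually_sequentially by blast

lemma rees_seqsI:
  assumes "\<And>k. t k \<in> tens_le J d k"
    and "\<And>N. \<exists>K. \<forall>k\<ge>K. t k \<in> tens_le J d (k - N)"
  shows "t \<in> rees_seqs J d"
proof -
  have "\<exists>K. \<forall>k\<ge>K. N \<le> k \<and> t k \<in> tens_le J d (k - N)" for N
  proof -
    obtain K where "\<forall>k\<ge>K. t k \<in> tens_le J d (k - N)"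
      using assms(2) by blast
    then show ?thesis
      by (intro exI [of _ "max K N"]) auto
  qed
  then show ?thesis
    using assms(1) unfolding rees_seqs_def eventually_sequentially by blast
qed

lemma rees_seqs_finite:
  assumes "\<And>k. t k \<in> tens_le J d k" "\<And>k. n \<le> k \<Longrightarrow> t k = 0"
  shows "t \<in> rees_seqs J d"
  by (intro rees_seqsI exI [of _ n]) (auto simp: assms)

lemma rees_seqs_const: "(\<lambda>k. Poly_Mapping.single 0 (z k)) \<in> rees_seqs J d"
  by (intro rees_seqsI) auto

lemma rees_seqs_add:
  assumes "s \<in> rees_seqs J d" "t \<in> rees_seqs J d"
  shows "(\<lambda>k. s k + t k) \<in> rees_seqs J d"
proof (rule rees_seqsI)
  fix N
  obtain K L where "\<And>k. K \<le> k \<Longrightarrow> N \<le> k \<and> s k \<in> tens_le J d (k - N)"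
      and "\<And>k. L \<le> k \<Longrightarrow> N \<le> k \<and> t k \<in> tens_le J d (k - N)"
    using rees_seqs_eventually assms by metis
  then show "\<exists>K. \<forall>k\<ge>K. s k + t k \<in> tens_le J d (k - N)"
    by (intro exI [of _ "max K L"]) (auto intro: tens_le_add)
qed (use assms in \<open>auto intro: tens_le_add rees_seqs_le\<close>)

text \<open>
  If \<open>k\<close> is large then in every term \<open>s i * t (k - i)\<close> one of the two indices is large, and the
  corresponding factor alone already falls short of its maximal length by \<open>N\<close>.
\<close>

lemma rees_seqs_cauchy:
  assumes "s \<in> rees_seqs J d" "t \<in> rees_seqs J d"
  shows "cauchy_prod s t \<in> rees_seqs J d"
proof (rule rees_seqsI)
  fix k
  have "s i * t (k - i) \<in> tens_le J d k" if "i \<le> k" for i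
    using tens_le_mult [OF rees_seqs_le [OF assms(1)] rees_seqs_le [OF assms(2)], of i "k - i"] that by simp
  then show "cauchy_prod s t k \<in> tens_le J d k"
    unfolding cauchy_prod_def by (intro tens_le_sum) simp
next
  fix N
  obtain K L where K: "\<And>k. K \<le> k \<Longrightarrow> N \<le> k \<and> s k \<in> tens_le J d (k - N)"
      and L: "\<And>k. L \<le> k \<Longrightarrow> N \<le> k \<and> t k \<in> tens_le J d (k - N)"
    using rees_seqs_eventually assms by metis
  have "s i * t (k - i) \<in> tens_le J d (k - N)" if k: "K + L \<le> k" and i: "i \<le> k" for k i
  proof (cases "K \<le> i")
    case True
    then have "s i * t (k - i) \<in> tens_le J d ((i - N) + (k - i))"
      using K by (intro tens_le_mult rees_seqs_le [OF assms(2)]) blast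
    moreover have "(i - N) + (k - i) = k - N"
      using K [OF True] i by simp
    ultimately show ?thesis
      by simp
  next
    case False
    then have *: "L \<le> k - i"
      using k by simp
    then have "s i * t (k - i) \<in> tens_le J d (i + (k - i - N))"
      using L by (intro tens_le_mult rees_seqs_le [OF assms(1)]) blast
    moreover have "N \<le> k - i"
      using L [OF *] by blast
    then have "i + (k - i - N) = k - N"
      using i by (simp add: le_diff_conv2)
    ultimately show ?thesis
      by simp
  qed
  then show "\<exists>K. \<forall>k\<ge>K. cauchy_prod s t k \<in> tens_le J d (k - N)"
    unfolding cauchy_prod_def by (intro exI [of _ "K + L"]) (auto intro: tens_le_sum)
qed

lemma rees_seqs_dilate:
  assumes "t \<in> rees_seqs J d"
  shows "(\<lambda>k. dilate c (t k)) \<in> rees_seqs J d"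
proof (rule rees_seqsI)
  fix N
  obtain K where "\<And>k. K \<le> k \<Longrightarrow> N \<le> k \<and> t k \<in> tens_le J d (k - N)"
    using rees_seqs_eventually assms by metis
  then show "\<exists>K. \<forall>k\<ge>K. dilate c (t k) \<in> tens_le J d (k - N)"
    by (intro exI [of _ K]) (auto intro: tens_le_dilate)
qed (use assms in \<open>auto intro: tens_le_dilate rees_seqs_le\<close>)

lemma bernstein_mono: "x \<in> bernstein J d a k \<Longrightarrow> k \<le> l \<Longrightarrow> x \<in> bernstein J d a l"
  by (auto simp: bernstein_def intro: tens_le_mono)

lemma weyl_order_le_iff:
  assumes "x \<in> bernstein J d a l"
  shows "weyl_order J d a x \<le> k \<longleftrightarrow> x \<in> bernstein J d a k"
proof
  have "x \<in> bernstein J d a (weyl_order J d a x)"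
    unfolding weyl_order_def using assms by (rule LeastI)
  then show "weyl_order J d a x \<le> k \<Longrightarrow> x \<in> bernstein J d a k"
    by (rule bernstein_mono)
qed (auto simp: weyl_order_def intro: Least_le)

text \<open>
  For the inclusion from left to right, each coefficient is represented by a tensor of length at most
  the order of that coefficient.
\<close>

lemma carrier_rees: "carrier (rees J d a) = rees_class J d a ` rees_seqs J d"
proof (intro equalityI subsetI)
  fix f assume f: "f \<in> carrier (rees J d a)"
  then have bern: "\<And>k. f k \<in> bernstein J d a k"
      and lim: "filterlim (\<lambda>k. int k - int (weyl_order J d a (f k))) at_top sequentially"
    by (simp_all add: rees_def)
  have "f k \<in> bernstein J d a (weyl_order J d a (f k))" for k
    using weyl_order_le_iff [OF bern [of k], of "weyl_order J d a (f k)"] by simp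
  then have "\<exists>t. t \<in> tens_le J d (weyl_order J d a (f k)) \<and> f k = weyl_class J d a t" for k
    unfolding bernstein_def by blast
  then obtain t where t: "\<And>k. t k \<in> tens_le J d (weyl_order J d a (f k))" "\<And>k. f k = weyl_class J d a (t k)"
    by metis
  have "t \<in> rees_seqs J d"
  proof (rule rees_seqsI)
    fix k
    have "weyl_order J d a (f k) \<le> k"
      using weyl_order_le_iff [OF bern [of k], of k] bern by simp
    with t(1) show "t k \<in> tens_le J d k"
      by (rule tens_le_mono)
  next
    fix N
    have "\<forall>\<^sub>F k in sequentially. int N \<le> int k - int (weyl_order J d a (f k))"
      using lim by (simp add: filterlim_at_top)
    then obtain K where "\<And>k. K \<le> k \<Longrightarrow> int N \<le> int k - int (weyl_order J d a (f k))"
      by (auto simp: eventually_sequentially)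
    then have "weyl_order J d a (f k) \<le> k - N" if "K \<le> k" for k
      using that by force
    then have "t k \<in> tens_le J d (k - N)" if "K \<le> k" for k
      using t(1) that by (blast intro: tens_le_mono)
    then show "\<exists>K. \<forall>k\<ge>K. t k \<in> tens_le J d (k - N)"
      by blast
  qed
  moreover have "f = rees_class J d a t"
    using t(2) by (auto simp: rees_class_def)
  ultimately show "f \<in> rees_class J d a ` rees_seqs J d"
    by blast
next
  fix f assume "f \<in> rees_class J d a ` rees_seqs J d"
  then obtain t where t: "t \<in> rees_seqs J d" "f = rees_class J d a t"
    by blast
  then have bern: "f k \<in> bernstein J d a k" for k
    by (auto simp: rees_class_def bernstein_def intro: rees_seqs_le)
  have "\<forall>\<^sub>F k in sequentially. Z \<le> int k - int (weyl_order J d a (f k))" for Z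
  proof -
    obtain K where K: "\<And>k. K \<le> k \<Longrightarrow> nat Z \<le> k \<and> t k \<in> tens_le J d (k - nat Z)"
      using rees_seqs_eventually t(1) by metis
    have "Z \<le> int k - int (weyl_order J d a (f k))" if "K \<le> k" for k
    proof -
      have "weyl_order J d a (f k) \<le> k - nat Z"
        using K [OF that] t(2) weyl_order_le_iff [OF bern [of k], of "k - nat Z"]
        by (auto simp: rees_class_def bernstein_def)
      then show ?thesis
        using K [OF that] by linarith
    qed
    then show ?thesis
      by (auto simp: eventually_sequentially)
  qed
  then show "f \<in> carrier (rees J d a)"
    using bern by (simp add: rees_def filterlim_at_top)
qed

lemma rees_class_closed: "t \<in> rees_seqs J d \<Longrightarrow> rees_class J d a t \<in> carrier (rees J d a)"
  by (simp add: carrier_rees)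

lemma rees_mult:
  assumes "s \<in> rees_seqs J d" "t \<in> rees_seqs J d"
  shows "rees_class J d a s \<otimes>\<^bsub>rees J d a\<^esub> rees_class J d a t = rees_class J d a (cauchy_prod s t)"
  using assms
  by (simp add: rees_def rees_class_def cauchy_prod_def weyl_class_mult finsum_weyl_class
      carrier_tens_mult rees_seqs_carrier)

lemma rees_add:
  assumes "s \<in> rees_seqs J d" "t \<in> rees_seqs J d"
  shows "rees_class J d a s \<oplus>\<^bsub>rees J d a\<^esub> rees_class J d a t = rees_class J d a (\<lambda>k. s k + t k)"
  using assms by (simp add: rees_def rees_class_def weyl_class_add rees_seqs_carrier)

lemma rees_const_class: "rees_const J d a c = rees_class J d a (\<lambda>k. Poly_Mapping.single 0 (fps_nth c k))"
  by (simp add: rees_const_def rees_class_def)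

lemma rees_one: "\<one>\<^bsub>rees J d a\<^esub> = rees_const J d a 1"
  by (simp add: rees_def rees_const_def weyl_class_one weyl_class_zero fun_eq_iff)

text \<open>
  Represents the series \<open>t \<hbar>\<^sup>n\<close>.
\<close>

definition homogeneous :: "nat \<Rightarrow> 'x tensor \<Rightarrow> nat \<Rightarrow> 'x tensor" where
  "homogeneous n t = (\<lambda>k. if k = n then t else 0)"

lemma rees_seqs_homogeneous: "t \<in> tens_le J d n \<Longrightarrow> homogeneous n t \<in> rees_seqs J d"
  by (rule rees_seqs_finite [of _ _ _ "Suc n"]) (auto simp: homogeneous_def)

lemma hbar_gen_class: "hbar_gen J d a f = rees_class J d a (homogeneous 1 f)"
  by (simp add: hbar_gen_def rees_class_def homogeneous_def weyl_class_zero fun_eq_iff)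

lemma cauchy_homogeneous:
  "cauchy_prod (homogeneous n t) s = (\<lambda>k. if n \<le> k then t * s (k - n) else 0)"
proof
  fix k
  have "cauchy_prod (homogeneous n t) s k = (\<Sum>i\<le>k. if i = n then t * s (k - n) else 0)"
    unfolding cauchy_prod_def by (intro sum.cong) (auto simp: homogeneous_def)
  then show "cauchy_prod (homogeneous n t) s k = (if n \<le> k then t * s (k - n) else 0)"
    by simp
qed

lemma dual_tens_le: "f \<in> dual J d \<Longrightarrow> f \<in> tens_le J d 1"
  by (auto simp: dual_def tens_le_def)

lemma semiclassical_class:
  assumes "finite J" "t \<in> rees_seqs J d" "B \<in> rep_space J d"
  shows "semiclassical J d a (rees_class J d a t) B = Sum_any (\<lambda>k. sym_part J d k (t k) B)"
  using assms
  by (simp add: semiclassical_def rees_class_def symb_weyl_class rees_seqs_le)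

lemma semiclassical_hbar_gen:
  assumes "finite J" "f \<in> dual J d"
  shows "semiclassical J d a (hbar_gen J d a f) = sym_part J d 1 f"
proof
  fix B
  show "semiclassical J d a (hbar_gen J d a f) B = sym_part J d 1 f B"
  proof (cases "B \<in> rep_space J d")
    case True
    have "(\<lambda>k. sym_part J d k (homogeneous 1 f k) B) = (\<lambda>k. sym_part J d 1 f B when k = 1)"
      using True by (auto simp: homogeneous_def sym_part_linext fun_eq_iff)
    then have "Sum_any (\<lambda>k. sym_part J d k (homogeneous 1 f k) B) = sym_part J d 1 f B"
      by (simp only: Sum_any_when_equal)
    then show ?thesis
      unfolding hbar_gen_class
      by (rule trans [OF semiclassical_class
            [OF assms(1) rees_seqs_homogeneous [OF dual_tens_le [OF assms(2)]] True]])
  qed (simp add: semiclassical_def sym_part_def)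
qed

text \<open>
  A linear form is recovered from its values on the coordinate vectors.
\<close>

lemma sym_part_dual_inject:
  assumes "finite J" "f \<in> dual J d" "h \<in> dual J d" "sym_part J d 1 f = sym_part J d 1 h"
  shows "f = h"
proof (rule poly_mapping_eqI)
  fix w
  show "Poly_Mapping.lookup f w = Poly_Mapping.lookup h w"
  proof (cases "w \<in> (\<lambda>x. Word [x]) ` coords J d")
    case True
    then obtain x where x: "x \<in> coords J d" "w = Word [x]"
      by blast
    let ?B = "\<lambda>y. if y = x then 1 else 0 :: complex"
    have B: "?B \<in> rep_space J d"
      using x by (auto simp: rep_space_def)
    have coeff: "sym_part J d 1 t ?B = Poly_Mapping.lookup t (Word [x])" if "t \<in> dual J d" for t
    proof -
      have "sym_part J d 1 t ?B = (\<Sum>y\<in>coords J d. if y = x then Poly_Mapping.lookup t (Word [x]) else 0)"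
        unfolding sym_part_linext [OF B] linext_dual [OF assms(1) that] by (intro sum.cong) auto
      then show ?thesis
        using x finite_coords [OF assms(1), of d] by simp
    qed
    show ?thesis
      using coeff [OF assms(2)] coeff [OF assms(3)] by (simp only: assms(4) x(2))
  next
    case False
    then show ?thesis
      using subsetD [OF dual_keys [OF assms(2)], of w] subsetD [OF dual_keys [OF assms(3)], of w]
      by (simp only: in_keys_iff) argo
  qed
qed

section \<open>Uniqueness\<close>

lemma rees_const_closed: "rees_const J d a c \<in> carrier (rees J d a)"
  by (simp add: rees_const_class rees_class_closed rees_seqs_const)

lemma cauchy_1_right: "cauchy_prod s (\<lambda>k. Poly_Mapping.single 0 (fps_nth 1 k)) = s"
proof
  fix k
  have "cauchy_prod s (\<lambda>k. Poly_Mapping.single 0 (fps_nth 1 k)) k = (\<Sum>i\<le>k. if i = k then s k else 0)"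
    unfolding cauchy_prod_def by (intro sum.cong) auto
  then show "cauchy_prod s (\<lambda>k. Poly_Mapping.single 0 (fps_nth 1 k)) k = s k"
    by simp
qed

lemma rees_const_mult_one: "rees_const J d a c \<otimes>\<^bsub>rees J d a\<^esub> \<one>\<^bsub>rees J d a\<^esub> = rees_const J d a c"
  unfolding rees_one by (simp only: rees_const_class rees_mult rees_seqs_const cauchy_1_right)

lemma rees_const_monomial:
  "rees_const J d a (fps_const z * fps_X ^ n) = rees_class J d a (homogeneous n (Poly_Mapping.single 0 z))"
  by (simp add: rees_const_class homogeneous_def if_distrib cong: if_cong)

lemma letter_in_dual: "x \<in> coords J d \<Longrightarrow> Poly_Mapping.single (Word [x]) 1 \<in> dual J d"
  by (simp add: dual_def carrier_tens)

lemma rees_alg_iso_hom: "\<Phi> \<in> rees_alg_iso J d b a \<Longrightarrow> \<Phi> \<in> ring_hom (rees J d b) (rees J d a)"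
  by (simp add: rees_alg_iso_def ring_iso_def)

lemma rees_iso_const:
  assumes "\<Phi> \<in> rees_alg_iso J d b a"
  shows "\<Phi> (rees_const J d b c) = rees_const J d a c"
proof -
  have "\<one>\<^bsub>rees J d b\<^esub> \<in> carrier (rees J d b)"
    by (simp add: rees_one rees_const_closed)
  then have "\<Phi> (rees_const J d b c \<otimes>\<^bsub>rees J d b\<^esub> \<one>\<^bsub>rees J d b\<^esub>) =
      rees_const J d a c \<otimes>\<^bsub>rees J d a\<^esub> \<Phi> \<one>\<^bsub>rees J d b\<^esub>"
    using assms by (simp add: rees_alg_iso_def)
  moreover have "\<Phi> \<one>\<^bsub>rees J d b\<^esub> = \<one>\<^bsub>rees J d a\<^esub>"
    using assms by (simp add: rees_alg_iso_def ring_iso_def ring_hom_one)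
  ultimately show ?thesis
    by (simp add: rees_const_mult_one)
qed

text \<open>
  Agreement spreads from the generators to words, to homogeneous elements and to finite series,
  and then to all series because the remainder after a finite part is divisible by any
  given power of \<open>\<hbar>\<close>.
\<close>

lemma rees_alg_iso_eqI:
  assumes iso: "\<Phi> \<in> rees_alg_iso J d b a" "\<Psi> \<in> rees_alg_iso J d b a"
    and gens: "\<And>f. f \<in> dual J d \<Longrightarrow> \<Phi> (hbar_gen J d b f) = \<Psi> (hbar_gen J d b f)"
  shows "\<Phi> = \<Psi>"
proof -
  let ?R = "rees J d b" and ?S = "rees J d a" and ?cl = "rees_class J d b"
  let ?agree = "\<lambda>t. \<Phi> (?cl t) = \<Psi> (?cl t)"
  have hom: "\<Phi> \<in> ring_hom ?R ?S" "\<Psi> \<in> ring_hom ?R ?S"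
    using iso by (simp_all add: rees_alg_iso_hom)
  have mult: "?agree (cauchy_prod s t)"
    if "s \<in> rees_seqs J d" "t \<in> rees_seqs J d" "?agree s" "?agree t" for s t
    using that
    by (simp add: rees_mult [symmetric] rees_class_closed ring_hom_mult [OF hom(1)] ring_hom_mult [OF hom(2)])
  have add: "?agree (\<lambda>k. s k + t k)"
    if "s \<in> rees_seqs J d" "t \<in> rees_seqs J d" "?agree s" "?agree t" for s t
    using that
    by (simp add: rees_add [symmetric] rees_class_closed ring_hom_add [OF hom(1)] ring_hom_add [OF hom(2)])
  have const: "?agree (homogeneous n (Poly_Mapping.single 0 z))" for n z
    unfolding rees_const_monomial [symmetric] by (simp add: rees_iso_const [OF iso(1)] rees_iso_const [OF iso(2)])
  have homog_mult: "homogeneous (m + n) (s * t) = cauchy_prod (homogeneous m s) (homogeneous n t)"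
    for m n and s t :: "'a coord tensor"
    unfolding cauchy_homogeneous by (auto simp: homogeneous_def fun_eq_iff)
  have word: "?agree (homogeneous (length xs) (Poly_Mapping.single (Word xs) 1))" if "set xs \<subseteq> coords J d" for xs
    using that
  proof (induction xs)
    case Nil
    show ?case
      using const [of 0 1] by (simp add: zero_word_def)
  next
    case (Cons x xs)
    let ?x = "Poly_Mapping.single (Word [x]) 1" and ?w = "Poly_Mapping.single (Word xs) 1"
    have x: "?x \<in> dual J d"
      using Cons.prems by (intro letter_in_dual) simp
    have "Poly_Mapping.single (Word (x # xs)) (1 :: complex) = ?x * ?w"
      by (simp add: mult_single plus_word_def)
    moreover have "?agree (homogeneous (1 + length xs) (?x * ?w))"
      unfolding homog_mult
    proof (rule mult)
      show "?agree (homogeneous 1 ?x)"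
        using gens [OF x] by (simp only: hbar_gen_class)
      show "?agree (homogeneous (length xs) ?w)"
        using Cons by simp
    qed (use x Cons.prems in \<open>auto intro!: rees_seqs_homogeneous dual_tens_le tens_le_single\<close>)
    ultimately show ?case
      by simp
  qed
  have single: "?agree (homogeneous n (Poly_Mapping.single w z))"
    if "set (letters w) \<subseteq> coords J d" "wlen w \<le> n" for n w z
  proof -
    \<comment> \<open>A word shorter than its power of \<open>\<hbar>\<close> is compensated by a power of \<open>\<hbar>\<close> in the scalars.\<close>
    have "Poly_Mapping.single w z = Poly_Mapping.single 0 z * Poly_Mapping.single w 1"
      by (simp add: mult_single)
    then have "homogeneous n (Poly_Mapping.single w z) =
        cauchy_prod (homogeneous (n - wlen w) (Poly_Mapping.single 0 z))
          (homogeneous (wlen w) (Poly_Mapping.single w 1))"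
      using homog_mult [of "n - wlen w" "wlen w"] that(2) by simp
    moreover have "?agree (homogeneous (wlen w) (Poly_Mapping.single w 1))"
      using word [OF that(1)] by simp
    ultimately show ?thesis
      using that const by (auto intro!: mult rees_seqs_homogeneous tens_le_single)
  qed
  have homog: "?agree (homogeneous n t)" if t: "t \<in> tens_le J d n" for n t
  proof -
    let ?part = "\<lambda>A. \<Sum>w\<in>A. Poly_Mapping.single w (Poly_Mapping.lookup t w)"
    have "?agree (homogeneous n (?part A))"
      if "finite A" "A \<subseteq> Poly_Mapping.keys t" for A
      using that
    proof (induction A)
      case empty
      then show ?case
        using const [of n 0] by simp
    next
      case (insert w A)
      have le: "Poly_Mapping.single v (Poly_Mapping.lookup t v) \<in> tens_le J d n" if "v \<in> insert w A" for v
        using t insert.prems that by (intro tens_le_single) (auto simp: tens_le_iff)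
      have "homogeneous n (?part (insert w A)) =
          (\<lambda>k. homogeneous n (Poly_Mapping.single w (Poly_Mapping.lookup t w)) k + homogeneous n (?part A) k)"
        using insert.hyps by (auto simp: homogeneous_def)
      moreover have "?agree (homogeneous n (Poly_Mapping.single w (Poly_Mapping.lookup t w)))"
        using t insert.prems by (intro single) (auto simp: tens_le_iff)
      ultimately show ?case
        using insert le by (auto intro!: add rees_seqs_homogeneous tens_le_sum)
    qed
    from this [OF finite_keys subset_refl] show ?thesis
      by (simp only: tensor_eq_sum_single [symmetric])
  qed
  have trunc: "?agree (\<lambda>k. if k < n then t k else 0)"
    if t: "\<And>k. t k \<in> tens_le J d k" for t n
  proof (induction n)
    case 0
    show ?case
      using const [of 0 0] by (simp add: homogeneous_def)
  next
    case (Suc n)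
    have "(\<lambda>k. if k < Suc n then t k else 0) =
        (\<lambda>k. (if k < n then t k else 0) + homogeneous n (t n) k)"
      by (auto simp: homogeneous_def less_Suc_eq)
    moreover have "(\<lambda>k. if k < n then t k else 0) \<in> rees_seqs J d"
      by (rule rees_seqs_finite [of _ _ _ n]) (auto simp: t)
    ultimately show ?case
      using Suc homog [OF t] t by (auto intro!: add rees_seqs_homogeneous)
  qed
  have "\<Phi> (?cl t) n = \<Psi> (?cl t) n" if t: "t \<in> rees_seqs J d" for t n
  proof -
    define N where "N = Suc n"
    \<comment> \<open>The finitely many terms with \<open>k < N\<close> or with \<open>t k\<close> longer than \<open>k - N\<close> make up \<open>p\<close>; the others,
      shifted down, give the cofactor \<open>q\<close> of \<open>\<hbar>\<^sup>N\<close>.  With \<open>N = n + 1\<close> the latter does not reach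
      the \<open>n\<close>-th coefficient.\<close>
    define p where "p k = (if N \<le> k \<and> t k \<in> tens_le J d (k - N) then 0 else t k)" for k
    define q where "q k = (if t (k + N) \<in> tens_le J d k then t (k + N) else 0)" for k
    obtain K where K: "\<And>k. K \<le> k \<Longrightarrow> N \<le> k \<and> t k \<in> tens_le J d (k - N)"
      using rees_seqs_eventually t by metis
    have p_le: "p k \<in> tens_le J d k" for k
      using t by (simp add: p_def rees_seqs_le)
    have p: "p = (\<lambda>k. if k < K then p k else 0)"
      using K by (auto simp: p_def fun_eq_iff not_less)
    have p_seq: "p \<in> rees_seqs J d"
      using p_le K by (intro rees_seqs_finite [of _ _ _ K]) (auto simp: p_def)
    have agree_p: "?agree p"
      using trunc [OF p_le, of K] by (simp only: p [symmetric])
    have q_seq: "q \<in> rees_seqs J d"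
    proof (rule rees_seqsI)
      fix M
      obtain L where L: "\<And>k. L \<le> k \<Longrightarrow> M + N \<le> k \<and> t k \<in> tens_le J d (k - (M + N))"
        using rees_seqs_eventually t by metis
      have "q k \<in> tens_le J d (k - M)" if "L \<le> k" for k
        using L [of "k + N"] that by (simp add: q_def)
      then show "\<exists>K. \<forall>k\<ge>K. q k \<in> tens_le J d (k - M)"
        by blast
    qed (simp add: q_def)
    let ?h = "homogeneous N (Poly_Mapping.single 0 1)"
    have h: "?h \<in> rees_seqs J d"
      by (simp add: rees_seqs_homogeneous)
    have t_split: "t = (\<lambda>k. p k + cauchy_prod ?h q k)"
      unfolding cauchy_homogeneous by (auto simp: p_def q_def)
    have split: "?cl t = ?cl p \<oplus>\<^bsub>?R\<^esub> (rees_const J d b (fps_const 1 * fps_X ^ N) \<otimes>\<^bsub>?R\<^esub> ?cl q)"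
      unfolding rees_const_monomial
      by (subst t_split) (simp only: rees_mult rees_add h p_seq q_seq rees_seqs_cauchy)
    have low: "\<Theta> (?cl t) n = \<Theta> (?cl p) n" if \<Theta>: "\<Theta> \<in> rees_alg_iso J d b a" for \<Theta>
    proof -
      have \<Theta>_hom: "\<Theta> \<in> ring_hom ?R ?S"
        using \<Theta> by (rule rees_alg_iso_hom)
      obtain p' where p': "p' \<in> rees_seqs J d" "\<Theta> (?cl p) = rees_class J d a p'"
        using ring_hom_closed [OF \<Theta>_hom rees_class_closed [OF p_seq]] by (auto simp: carrier_rees)
      obtain q' where q': "q' \<in> rees_seqs J d" "\<Theta> (?cl q) = rees_class J d a q'"
        using ring_hom_closed [OF \<Theta>_hom rees_class_closed [OF q_seq]] by (auto simp: carrier_rees)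
      let ?u = "rees_const J d b (fps_const 1 * fps_X ^ N) \<otimes>\<^bsub>?R\<^esub> ?cl q"
      have "\<Theta> ?u =
          rees_const J d a (fps_const 1 * fps_X ^ N) \<otimes>\<^bsub>?S\<^esub> \<Theta> (?cl q)"
        using \<Theta> rees_class_closed [OF q_seq] by (simp add: rees_alg_iso_def)
      then have u: "\<Theta> ?u = rees_class J d a (cauchy_prod ?h q')"
        unfolding rees_const_monomial q'(2) by (simp only: rees_mult h q'(1))
      have u_closed: "?u \<in> carrier ?R"
        unfolding rees_const_monomial by (simp only: rees_mult rees_class_closed h q_seq rees_seqs_cauchy)
      have "\<Theta> (?cl t) = \<Theta> (?cl p) \<oplus>\<^bsub>?S\<^esub> \<Theta> ?u"
        unfolding split by (rule ring_hom_add [OF \<Theta>_hom rees_class_closed [OF p_seq] u_closed])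
      also have "\<dots> = rees_class J d a (\<lambda>k. p' k + cauchy_prod ?h q' k)"
        unfolding p'(2) u by (rule rees_add [OF p'(1) rees_seqs_cauchy [OF h q'(1)]])
      finally have "\<Theta> (?cl t) = rees_class J d a (\<lambda>k. p' k + cauchy_prod ?h q' k)" .
      then show ?thesis
        unfolding p'(2) cauchy_homogeneous by (simp add: rees_class_def N_def)
    qed
    show ?thesis
      using low [OF iso(1)] low [OF iso(2)] agree_p by simp
  qed
  then have "\<Phi> f = \<Psi> f" if "f \<in> carrier ?R" for f
    using that by (auto simp: carrier_rees fun_eq_iff)
  then show ?thesis
    using iso by (intro extensionalityI [of _ "carrier ?R"]) (auto simp: rees_alg_iso_def)
qed

text \<open>
  On a generator, linearity leaves only the freedom of an element of the dual, which the
  semiclassical limit then fixes.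
\<close>

lemma quantum_pullback_unique:
  assumes "finite J" "is_quantum_pullback J d g a \<Phi>" "is_quantum_pullback J d g a \<Psi>"
  shows "\<Phi> = \<Psi>"
proof (rule rees_alg_iso_eqI)
  show "\<Phi> \<in> rees_alg_iso J d (act a g) a" "\<Psi> \<in> rees_alg_iso J d (act a g) a"
    using assms by (auto simp: is_quantum_pullback_def)
next
  fix f assume f: "f \<in> dual J d"
  let ?f = "hbar_gen J d (act a g) f"
  obtain h where h: "h \<in> dual J d" "\<Phi> ?f = hbar_gen J d a h"
    using assms(2) f unfolding is_quantum_pullback_def linear_on_gens_def by blast
  obtain k where k: "k \<in> dual J d" "\<Psi> ?f = hbar_gen J d a k"
    using assms(3) f unfolding is_quantum_pullback_def linear_on_gens_def by blast
  have "?f \<in> carrier (rees J d (act a g))"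
    unfolding hbar_gen_class by (intro rees_class_closed rees_seqs_homogeneous dual_tens_le f)
  then have "semiclassical J d a (\<Phi> ?f) = semiclassical J d a (\<Psi> ?f)"
    using assms by (simp add: is_quantum_pullback_def intertwines_def)
  then have "sym_part J d 1 h = sym_part J d 1 k"
    using assms(1) h k by (simp only: semiclassical_hbar_gen)
  then have "h = k"
    using assms(1) h(1) k(1) by (intro sym_part_dual_inject)
  then show "\<Phi> ?f = \<Psi> ?f"
    using h k by simp
qed

section \<open>Existence and functoriality\<close>

definition rees_dilate :: "'j set \<Rightarrow> ('j \<Rightarrow> nat) \<Rightarrow> ('j \<Rightarrow> cp1) \<Rightarrow> ('j coord \<Rightarrow> complex) \<Rightarrow>
    (nat \<Rightarrow> 'j coord tensor set) \<Rightarrow> nat \<Rightarrow> 'j coord tensor set" where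
  "rees_dilate J d b c = (\<lambda>f\<in>carrier (rees J d b). \<lambda>k. dilate c ` f k)"

lemma rees_dilate_class:
  assumes "poisson_scaling J d b a c" "t \<in> rees_seqs J d"
  shows "rees_dilate J d b c (rees_class J d b t) = rees_class J d a (\<lambda>k. dilate c (t k))"
  using assms by (simp add: rees_dilate_def rees_class_closed) (simp add: rees_class_def dilate_weyl_class)

lemma cauchy_dilate: "(\<lambda>k. dilate c (cauchy_prod s t k)) = cauchy_prod (\<lambda>k. dilate c (s k)) (\<lambda>k. dilate c (t k))"
  by (simp add: cauchy_prod_def dilate_sum dilate_mult)

lemma rees_dilate_iso:
  assumes "poisson_scaling J d b a c"
  shows "rees_dilate J d b c \<in> rees_alg_iso J d b a"
proof -
  let ?R = "rees J d b" and ?S = "rees J d a" and ?F = "rees_dilate J d b c"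
  note F = rees_dilate_class [OF assms]
  have mult: "?F (f \<otimes>\<^bsub>?R\<^esub> h) = ?F f \<otimes>\<^bsub>?S\<^esub> ?F h" if "f \<in> carrier ?R" "h \<in> carrier ?R" for f h
    using that by (auto simp: carrier_rees rees_mult F rees_seqs_cauchy rees_seqs_dilate cauchy_dilate)
  have const: "?F (rees_const J d b z) = rees_const J d a z" for z
    unfolding rees_const_class by (simp add: F rees_seqs_const)
  have "?F \<in> ring_hom ?R ?S"
  proof (rule ring_hom_memI)
    show "?F f \<in> carrier ?S" if "f \<in> carrier ?R" for f
      using that by (auto simp: carrier_rees F rees_seqs_dilate)
    show "?F (f \<oplus>\<^bsub>?R\<^esub> h) = ?F f \<oplus>\<^bsub>?S\<^esub> ?F h" if "f \<in> carrier ?R" "h \<in> carrier ?R" for f h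
      using that by (auto simp: carrier_rees rees_add F rees_seqs_add rees_seqs_dilate dilate_add)
  qed (simp_all add: mult rees_one const)
  moreover have "bij_betw ?F (carrier ?R) (carrier ?S)"
  proof (rule bij_betwI)
    let ?c = "\<lambda>x. inverse (c x)"
    note G = rees_dilate_class [OF poisson_inverse [OF assms]]
    have inv: "dilate ?c (dilate c t) = t" "dilate c (dilate ?c t) = t" for t
      using dilate_inverse [of ?c t] dilate_inverse [of c t] poisson_nonzero [OF assms] by auto
    show "?F \<in> carrier ?R \<rightarrow> carrier ?S" "rees_dilate J d a ?c \<in> carrier ?S \<rightarrow> carrier ?R"
      by (auto simp: carrier_rees F G rees_seqs_dilate)
    show "rees_dilate J d a ?c (?F f) = f" if "f \<in> carrier ?R" for f
      using that by (auto simp: carrier_rees F G rees_seqs_dilate inv)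
    show "?F (rees_dilate J d a ?c f) = f" if "f \<in> carrier ?S" for f
      using that by (auto simp: carrier_rees F G rees_seqs_dilate inv)
  qed
  ultimately show ?thesis
    by (simp add: rees_alg_iso_def ring_iso_def mult const rees_const_closed) (simp add: rees_dilate_def)
qed

definition eta_coord :: "complex^2^2 \<Rightarrow> ('j \<Rightarrow> cp1) \<Rightarrow> 'j coord \<Rightarrow> complex" where
  "eta_coord g a x = eta (fst x) g a"

lemma poisson_eta:
  assumes "g \<in> SL2"
  shows "poisson_scaling J d (act a g) a (eta_coord g a)"
  unfolding poisson_scaling_def
proof (intro conjI allI ballI)
  show "eta_coord g a x \<noteq> 0" for x
    by (simp add: eta_coord_def eta_def eta_pt_nonzero assms)
next
  fix x y :: "'a coord"
  obtain i j k l i' j' k' l' where xy: "x = (i, j, k, l)" "y = (i', j', k', l')"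
    by (cases x; cases y) blast
  have "eta i g a * eta j g a * inverse (eps a i j) = inverse (eps (act a g) i j)"
    unfolding eta_def eps_def act_def eps_pt_mobius [OF assms, of "a i" "a j"]
    using eta_pt_nonzero [OF assms] by (simp add: field_simps)
  then show "eta_coord g a x * eta_coord g a y * coord_bracket a x y = coord_bracket (act a g) x y"
    by (auto simp: xy eta_coord_def)
qed

lemma phi_eta_coord: "phi g a B = (\<lambda>x. eta_coord g a x * B x)"
  by (auto simp: phi_def eta_coord_def)

lemma phi_rep_space: "B \<in> rep_space J d \<Longrightarrow> phi g a B \<in> rep_space J d"
  by (simp add: rep_space_def phi_eta_coord)

lemma quantum_pullback_exists:
  assumes "finite J" "g \<in> SL2"
  shows "is_quantum_pullback J d g a (rees_dilate J d (act a g) (eta_coord g a))"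
proof -
  let ?c = "eta_coord g a" and ?b = "act a g"
  note c = poisson_eta [OF assms(2), of J d a]
  note F = rees_dilate_class [OF c]
  have "linear_on_gens J d ?b a (rees_dilate J d ?b ?c)"
    unfolding linear_on_gens_def
  proof
    fix f assume f: "f \<in> dual J d"
    have "(\<lambda>k. dilate ?c (homogeneous 1 f k)) = homogeneous 1 (dilate ?c f)"
      by (auto simp: homogeneous_def)
    then have "rees_dilate J d ?b ?c (hbar_gen J d ?b f) = hbar_gen J d a (dilate ?c f)"
      using f by (simp only: hbar_gen_class F rees_seqs_homogeneous dual_tens_le)
    then show "\<exists>h\<in>dual J d. rees_dilate J d ?b ?c (hbar_gen J d ?b f) = hbar_gen J d a h"
      using dual_dilate [OF f] by (rule bexI)
  qed
  moreover have "intertwines J d g a (rees_dilate J d ?b ?c)"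
    unfolding intertwines_def carrier_rees
  proof (intro ballI)
    fix f assume "f \<in> rees_class J d ?b ` rees_seqs J d"
    then obtain t where t: "t \<in> rees_seqs J d" "f = rees_class J d ?b t"
      by blast
    show "semiclassical J d a (rees_dilate J d ?b ?c f) = pullback J d g a (semiclassical J d ?b f)"
    proof
      fix B
      show "semiclassical J d a (rees_dilate J d ?b ?c f) B = pullback J d g a (semiclassical J d ?b f) B"
      proof (cases "B \<in> rep_space J d")
        case True
        then have "sym_part J d k (dilate ?c (t k)) B = sym_part J d k (t k) (phi g a B)" for k
          using phi_rep_space [OF True, of g a] unfolding phi_eta_coord by (rule sym_part_dilate)
        then show ?thesis
          using assms(1) t True
          by (simp add: F semiclassical_class rees_seqs_dilate pullback_def phi_rep_space)
      qed (simp add: semiclassical_def pullback_def)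
    qed
  qed
  ultimately show ?thesis
    using rees_dilate_iso [OF c] by (simp add: is_quantum_pullback_def)
qed

lemma quantum_pullback_eq:
  assumes "finite J" "g \<in> SL2"
  shows "quantum_pullback J d g a = rees_dilate J d (act a g) (eta_coord g a)"
  unfolding quantum_pullback_def
proof (rule the_equality)
  show "is_quantum_pullback J d g a (rees_dilate J d (act a g) (eta_coord g a))"
    by (rule quantum_pullback_exists [OF assms])
  then show "\<Phi> = rees_dilate J d (act a g) (eta_coord g a)" if "is_quantum_pullback J d g a \<Phi>" for \<Phi>
    using that by (intro quantum_pullback_unique [OF assms(1)])
qed

lemma eta_coord_mult:
  assumes "g \<in> SL2" "g' \<in> SL2"
  shows "eta_coord (g ** g') a = (\<lambda>x. eta_coord g a x * eta_coord g' (act a g) x)"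
  by (simp add: eta_coord_def eta_def act_def mobius_eta_mult [OF assms] fun_eq_iff)

theorem theorem3p11:
  fixes J :: "'j set" and d :: "'j \<Rightarrow> nat"
    and g :: "complex^2^2" and a :: "'j \<Rightarrow> cp1"
  assumes "finite J" and "g \<in> SL2" and "a \<in> embeddings J"
  shows "(\<exists>!\<Phi>. \<Phi> \<in> rees_alg_iso J d (act a g) a \<and> linear_on_gens J d (act a g) a \<Phi> \<and>
                intertwines J d g a \<Phi>) \<and>
         (\<forall>g' \<in> SL2. quantum_pullback J d (g ** g') a =
            compose (carrier (rees J d (act a (g ** g'))))
              (quantum_pullback J d g a) (quantum_pullback J d g' (act a g)))"
proof (intro conjI ballI)
  have "\<exists>!\<Phi>. is_quantum_pullback J d g a \<Phi>"
  proof (rule ex1I)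
    show ex: "is_quantum_pullback J d g a (rees_dilate J d (act a g) (eta_coord g a))"
      by (rule quantum_pullback_exists [OF assms(1,2)])
    show "\<Phi> = rees_dilate J d (act a g) (eta_coord g a)" if "is_quantum_pullback J d g a \<Phi>" for \<Phi>
      by (rule quantum_pullback_unique [OF assms(1) that ex])
  qed
  then show "\<exists>!\<Phi>. \<Phi> \<in> rees_alg_iso J d (act a g) a \<and> linear_on_gens J d (act a g) a \<Phi> \<and>
      intertwines J d g a \<Phi>"
    by (simp only: is_quantum_pullback_def)
next
  fix g' assume g': "g' \<in> SL2"
  let ?b = "act a g" and ?R = "rees J d (act (act a g) g')"
  have act: "act a (g ** g') = act ?b g'"
    by (rule act_mult [OF assms(2) g'])
  show "quantum_pullback J d (g ** g') a =
      compose (carrier (rees J d (act a (g ** g')))) (quantum_pullback J d g a) (quantum_pullback J d g' ?b)"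
    unfolding quantum_pullback_eq [OF assms(1) SL2_mult [OF assms(2) g']]
      quantum_pullback_eq [OF assms(1,2)] quantum_pullback_eq [OF assms(1) g'] act
  proof (rule extensionalityI [of _ "carrier ?R"])
    fix f assume f: "f \<in> carrier ?R"
    then have "rees_dilate J d (act ?b g') (eta_coord g' ?b) f \<in> carrier (rees J d ?b)"
      by (rule ring_hom_closed [OF rees_alg_iso_hom [OF rees_dilate_iso [OF poisson_eta [OF g']]]])
    with f show "rees_dilate J d (act ?b g') (eta_coord (g ** g') a) f =
        compose (carrier ?R) (rees_dilate J d ?b (eta_coord g a)) (rees_dilate J d (act ?b g') (eta_coord g' ?b)) f"
      by (simp add: compose_def rees_dilate_def image_image dilate_dilate eta_coord_mult [OF assms(2) g'])
  qed (simp_all add: rees_dilate_def)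
qed

end
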